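(* Let $\mathsf C$ and $\mathsf P$ be LCLs for labelled graphs. Let $\mathcal G=(V,E,\mathcal B)$ be a locally finite Borel graph with a Borel labelling $\ell:V\to\omega$ and a Borel assignment $a_0:V\to\omega$ that solves $\mathsf C$ on $(\mathcal G,\ell)$. Then for every $r\ge 1$ there is a Borel assignment $a:V\to\omega$ such that $a$ solves $\mathsf C$ on $(\mathcal G,\ell)$ and admits no $r$-augmentation with respect to $\mathsf P$. Additionally, there are $r$ Borel maps $$f_j:\mathsf P(\mathcal G,(\ell,a))\setminus\mathsf P(\mathcal G,(\ell,a_0))\to V,\quad j\in r,$$ such that the graph of each $f_j$ is contained in the connectivity relation $\mathcal E_{\mathcal G}$ (i.e. $f_j(x)$ lies in the connectivity component of $x$) and every vertex $x\in V$ with $a(x)\neq a_0(x)$ is in the image of at least one $f_j$.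
   Context: A Borel graph is a triple $(V,E,\mathcal B)$ where $(V,\mathcal B)$ is a standard Borel space, $E\subseteq V^2$ is symmetric, disjoint from the diagonal, and Borel in $V^2$; locally finite means all neighbourhoods are finite. A labelling/assignment into $\omega$ is Borel if all preimages are Borel; $r$ is identified with $\{0,\dots,r-1\}$. A local rule of radius $t$ on a labelled graph is a function on vertices whose value at $x$ depends only on the isomorphism type of the rooted labelled graph induced on the vertices at distance at most $t$ from $x$. An LCL is a $\{0,1\}$-valued local rule defined on graphs with $\omega^2$-valued labellings; for an assignment $a:V\to\omega$, $\mathsf C(\mathcal G,(\ell,a))$ denotes the set of vertices where $\mathsf C$ evaluated on $(\mathcal G,(\ell,a))$, with $(\ell,a)(x)=(\ell(x),a(x))$, returns $1$, and $a$ solves $\mathsf C$ if this set is all of $V$. $\mathsf P(\mathcal G,(\ell,a))$ (the progress set) is defined analogously. For an assignment $a$ solving $\mathsf C$, a set $R\subseteq V$ is $r$-augmenting if the induced subgraph on $R$ is connected, $|R|\le r$, and there is $b:R\to\omega$ such that the assignment $a\leadsto b$ (equal to $b$ on $R$ and to $a$ on $V\setminus R$) solves $\mathsf C$ and $\mathsf P(\mathcal G,(\ell,a))\subsetneq\mathsf P(\mathcal G,(\ell,a\leadsto b))$; such $a\leadsto b$ is called an $r$-augmentation of $a$. *)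

theory Defs
  imports "HOL-Analysis.Analysis" "HOL-Library.Extended_Nat"
begin

text \<open>
  Measurable spaces are values of type \<^typ>\<open>'a measure\<close>; only \<^const>\<open>space\<close> and
  \<^const>\<open>sets\<close> are used, the measure itself plays no role.
\<close>

definition standard_borel :: "'a measure \<Rightarrow> bool" where
  "standard_borel M \<longleftrightarrow>
     (\<exists>X. completely_metrizable_space X \<and> separable_space X \<and> topspace X = space M \<and>
          sets M = sigma_sets (space M) {U. openin X U})"

definition sgraph :: "'a set \<Rightarrow> ('a \<times> 'a) set \<Rightarrow> bool" where
  "sgraph V E \<longleftrightarrow> E \<subseteq> V \<times> V \<and> sym E \<and> irrefl E"

definition locally_finite :: "'a set \<Rightarrow> ('a \<times> 'a) set \<Rightarrow> bool" where
  "locally_finite V E \<longleftrightarrow> (\<forall>x\<in>V. finite (E `` {x}))"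

definition borel_graph :: "'a measure \<Rightarrow> ('a \<times> 'a) set \<Rightarrow> bool" where
  "borel_graph M E \<longleftrightarrow>
     standard_borel M \<and> sgraph (space M) E \<and> E \<in> sets (M \<Otimes>\<^sub>M M)"

text \<open>The distance is \<open>\<infinity>\<close> between different components, since the infimum of the empty set is \<open>\<infinity>\<close>.\<close>

definition gdist :: "('a \<times> 'a) set \<Rightarrow> 'a \<Rightarrow> 'a \<Rightarrow> enat" where
  "gdist E x y = (INF n\<in>{n. (x, y) \<in> E ^^ n}. enat n)"

definition gball :: "'a set \<Rightarrow> ('a \<times> 'a) set \<Rightarrow> nat \<Rightarrow> 'a \<Rightarrow> 'a set" where
  "gball V E t x = {y \<in> V. gdist E x y \<le> enat t}"

definition connectivity_rel :: "'a set \<Rightarrow> ('a \<times> 'a) set \<Rightarrow> ('a \<times> 'a) set" where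
  "connectivity_rel V E = {(x, y). x \<in> V \<and> y \<in> V \<and> (x, y) \<in> E\<^sup>*}"

definition induced_connected :: "('a \<times> 'a) set \<Rightarrow> 'a set \<Rightarrow> bool" where
  "induced_connected E R \<longleftrightarrow> (\<forall>x\<in>R. \<forall>y\<in>R. (x, y) \<in> (E \<inter> R \<times> R)\<^sup>*)"

text \<open>Isomorphism of the rooted labelled graphs induced by \<open>E\<close> on \<open>A\<close> and by \<open>E'\<close> on \<open>A'\<close>.\<close>

definition rooted_labelled_iso ::
  "'a set \<Rightarrow> ('a \<times> 'a) set \<Rightarrow> ('a \<Rightarrow> 'l) \<Rightarrow> 'a \<Rightarrow>
   'a set \<Rightarrow> ('a \<times> 'a) set \<Rightarrow> ('a \<Rightarrow> 'l) \<Rightarrow> 'a \<Rightarrow> bool" where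
  "rooted_labelled_iso A E l x A' E' l' x' \<longleftrightarrow>
     (\<exists>\<phi>. bij_betw \<phi> A A' \<and> \<phi> x = x' \<and>
          (\<forall>y\<in>A. \<forall>z\<in>A. (y, z) \<in> E \<longleftrightarrow> (\<phi> y, \<phi> z) \<in> E') \<and>
          (\<forall>y\<in>A. l' (\<phi> y) = l y))"

text \<open>
  A rule takes a graph \<open>(V, E)\<close>, a labelling and a vertex.  Its values matter only if \<open>(V, E)\<close> is
  a graph and the vertex belongs to \<open>V\<close>.  The locality condition compares vertices of two
  possibly different graphs, where \<open>V\<close> and \<open>V'\<close> range over all subsets of the vertex type.
\<close>

type_synonym ('a, 'l, 'c) rule =
  "'a set \<Rightarrow> ('a \<times> 'a) set \<Rightarrow> ('a \<Rightarrow> 'l) \<Rightarrow> 'a \<Rightarrow> 'c"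

definition local_rule :: "nat \<Rightarrow> ('a, 'l, 'c) rule \<Rightarrow> bool" where
  "local_rule t \<R> \<longleftrightarrow>
     (\<forall>V E l x V' E' l' x'.
        sgraph V E \<longrightarrow> x \<in> V \<longrightarrow> sgraph V' E' \<longrightarrow> x' \<in> V' \<longrightarrow>
        rooted_labelled_iso (gball V E t x) E l x (gball V' E' t x') E' l' x' \<longrightarrow>
        \<R> V E l x = \<R> V' E' l' x')"

definition LCL :: "('a, nat \<times> nat, nat) rule \<Rightarrow> bool" where
  "LCL \<C> \<longleftrightarrow>
     (\<exists>t. local_rule t \<C>) \<and>
     (\<forall>V E l x. sgraph V E \<longrightarrow> x \<in> V \<longrightarrow> \<C> V E l x \<in> {0, 1})"

definition lcl_set ::
  "('a, nat \<times> nat, nat) rule \<Rightarrow> 'a set \<Rightarrow> ('a \<times> 'a) set \<Rightarrow> ('a \<Rightarrow> nat) \<Rightarrow> ('a \<Rightarrow> nat) \<Rightarrow> 'a set" where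
  "lcl_set \<C> V E l a = {x \<in> V. \<C> V E (\<lambda>y. (l y, a y)) x = 1}"

definition solves ::
  "('a, nat \<times> nat, nat) rule \<Rightarrow> 'a set \<Rightarrow> ('a \<times> 'a) set \<Rightarrow> ('a \<Rightarrow> nat) \<Rightarrow> ('a \<Rightarrow> nat) \<Rightarrow> bool" where
  "solves \<C> V E l a \<longleftrightarrow> lcl_set \<C> V E l a = V"

definition augmentation ::
  "('a, nat \<times> nat, nat) rule \<Rightarrow> ('a, nat \<times> nat, nat) rule \<Rightarrow> 'a set \<Rightarrow> ('a \<times> 'a) set \<Rightarrow>
   ('a \<Rightarrow> nat) \<Rightarrow> nat \<Rightarrow> ('a \<Rightarrow> nat) \<Rightarrow> ('a \<Rightarrow> nat) \<Rightarrow> bool" where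
  "augmentation \<C> \<P> V E l r a a' \<longleftrightarrow>
     (\<exists>R b. R \<subseteq> V \<and> induced_connected E R \<and> finite R \<and> card R \<le> r \<and>
            a' = override_on a b R \<and> solves \<C> V E l a' \<and>
            lcl_set \<P> V E l a \<subset> lcl_set \<P> V E l a')"

end

theory Submission
  imports Defs
begin

text \<open>
  A Borel set with finite sections is covered by countably many graphs of Borel functions; this
  special case of the Lusin--Novikov theorem follows from Novikov's separation theorem for
  sequences of analytic sets. Applied to the edge relation, it turns quantifiers over the vertices
  of a component into quantifiers over words, so everything defined locally is Borel.

  The augmentations are carried out in countably many stages. A stage prescribes which vertices to
  change relative to a root, and to which values, and it acts at all roots in a Borel set of
  pairwise distant vertices where this is an augmentation. Countably many such sets cover the
  graph, since a finite ball around a vertex meets some basic open set in this vertex only.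
  Each change near a vertex puts a new vertex of a fixed finite ball into the progress set, so
  every value stabilises. An augmentation of the limit would be an augmentation at all late stages
  and hence would have been carried out. Finally \<open>f\<^sub>j\<close> sends a vertex entering the progress set to
  the \<open>j\<close>-th vertex changed at that moment around the unique root nearby.
\<close>

section \<open>Analytic sets and separation\<close>

text \<open>A Borel set projects to a set that is only analytic, so a question such as "does x have
  a neighbour in B" is a priori not Borel. Separation replaces the projections by Borel sets; once
  Borel functions run through the neighbours, only countable Boolean operations occur.

  Everything that identifies a stage of the process is finite data: the index of a basic open set
  and a list of words with values. Hence there are countably many instructions and each can recur
  beyond any bound. This is essential, since an augmentation of the limit is visible only from some
  unknown stage on.

  A change lies in the ball of radius \<rho> around its root and can affect a rule of radius t only
  within \<rho> + t. Roots at distance above 2(\<rho> + t) therefore act independently, and a vertex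
  entering the progress set determines the root that brought it in. Connectedness of an augmenting
  set enters through the bound \<open>r * r\<close> on its radius; the process itself admits every
  change of at most \<open>r\<close> vertices inside such a ball.\<close>

lemma open_contains_cylinder:
  fixes U :: "(nat \<Rightarrow> nat) set"
  assumes "open U" "y \<in> U"
  obtains m where "\<And>z. (\<And>i. i < m \<Longrightarrow> z i = y i) \<Longrightarrow> z \<in> U"
proof -
  have "openin (product_topology (\<lambda>i. euclidean) UNIV) U"
    using assms(1) by (simp add: open_fun_def)
  from product_topology_open_contains_basis[OF this assms(2)]
  obtain X where X: "y \<in> (\<Pi>\<^sub>E i\<in>UNIV. X i)" "finite {i. X i \<noteq> topspace (euclidean :: nat topology)}"
    "(\<Pi>\<^sub>E i\<in>UNIV. X i) \<subseteq> U"
    by blast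
  obtain m where m: "\<And>i. X i \<noteq> UNIV \<Longrightarrow> i < m"
    using X(2) finite_nat_set_iff_bounded by auto
  show thesis
  proof
    fix z :: "nat \<Rightarrow> nat"
    assume z: "\<And>i. i < m \<Longrightarrow> z i = y i"
    have "z i \<in> X i" for i
      using z[of i] m[of i] X(1) by (cases "X i = UNIV") (auto simp: PiE_iff)
    then show "z \<in> U"
      using X(3) by auto
  qed
qed

lemma open_cylinder: "open {z :: nat \<Rightarrow> nat. \<forall>i<m. z i = y i}"
proof -
  have "open {z :: nat \<Rightarrow> nat. z i = y i}" for i
    using open_vimage[OF _ continuous_on_product_coordinates[of i], of "{y i}"]
    by (simp add: vimage_def open_discrete)
  moreover have "{z :: nat \<Rightarrow> nat. \<forall>i<m. z i = y i} = (\<Inter>i\<in>{..<m}. {z. z i = y i})"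
    by auto
  ultimately show ?thesis
    by auto
qed

lemma openin_cylinderI:
  fixes S :: "(nat \<Rightarrow> nat) set"
  assumes "A \<subseteq> S"
    and "\<And>y. y \<in> A \<Longrightarrow> \<exists>m. \<forall>z\<in>S. (\<forall>i<m. z i = y i) \<longrightarrow> z \<in> A"
  shows "openin (top_of_set S) A"
proof (subst openin_subopen, intro ballI)
  fix y assume y: "y \<in> A"
  then obtain m where "\<forall>z\<in>S. (\<forall>i<m. z i = y i) \<longrightarrow> z \<in> A"
    using assms(2) by blast
  moreover have "openin (top_of_set S) (S \<inter> {z. \<forall>i<m. z i = y i})"
    using open_cylinder by (auto simp: openin_open)
  ultimately show "\<exists>Q. openin (top_of_set S) Q \<and> y \<in> Q \<and> Q \<subseteq> A"
    using y assms(1) by (intro exI[of _ "S \<inter> {z. \<forall>i<m. z i = y i}"]) auto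
qed

lemma continuous_on_reindex:
  fixes h :: "'i \<Rightarrow> 'j"
  shows "continuous_on S (\<lambda>z :: 'j \<Rightarrow> 'b :: topological_space. \<lambda>k. z (h k))"
  by (intro continuous_on_coordinatewise_then_product
      continuous_on_subset[OF continuous_on_product_coordinates]) simp

lemma closed_reindex_vimage:
  fixes h :: "'i \<Rightarrow> 'j" and S :: "('i \<Rightarrow> 'b :: topological_space) set"
  assumes "closed S"
  shows "closed {z. (\<lambda>k. z (h k)) \<in> S}"
  using closed_vimage[OF assms continuous_on_reindex] by (simp add: vimage_def)

lemma continuous_map_reindex:
  fixes h :: "'i \<Rightarrow> 'j" and S :: "('i \<Rightarrow> 'b :: topological_space) set"
  assumes "continuous_map (top_of_set S) T f" "\<And>z. z \<in> S' \<Longrightarrow> (\<lambda>k. z (h k)) \<in> S"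
  shows "continuous_map (top_of_set S') T (\<lambda>z. f (\<lambda>k. z (h k)))"
proof -
  have "continuous_map (top_of_set S') (top_of_set S) (\<lambda>z k. z (h k))"
    using assms(2) by (auto simp: continuous_on_reindex)
  from continuous_map_compose[OF this assms(1)] show ?thesis
    by (simp add: o_def)
qed

text \<open>Parametrising by a closed subset of Baire space, and not by the whole of it, covers the
  empty set uniformly and lets closed side conditions be imposed on the parameters without a
  retraction.\<close>

definition analytic_in :: "'a topology \<Rightarrow> 'a set \<Rightarrow> bool" where
  "analytic_in T A \<longleftrightarrow>
     (\<exists>(S :: (nat \<Rightarrow> nat) set) f. closed S \<and> continuous_map (top_of_set S) T f \<and> A = f ` S)"

lemma analytic_inI:
  fixes S :: "(nat \<Rightarrow> nat) set"
  assumes "closed S" "continuous_map (top_of_set S) T f" "A = f ` S"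
  shows "analytic_in T A"
  unfolding analytic_in_def using assms by blast

lemma analytic_inE:
  assumes "analytic_in T A"
  obtains S :: "(nat \<Rightarrow> nat) set" and f
  where "closed S" "continuous_map (top_of_set S) T f" "A = f ` S"
  using assms unfolding analytic_in_def by blast

lemma analytic_in_subset: "analytic_in T A \<Longrightarrow> A \<subseteq> topspace T"
  by (elim analytic_inE) (use continuous_map_image_subset_topspace in fastforce)

section \<open>Closure properties of analytic sets\<close>

lemma analytic_in_empty [simp]: "analytic_in T {}"
  by (rule analytic_inI[of "{}"]) auto

lemma analytic_in_continuous_image:
  assumes "analytic_in T A" "continuous_map T T' g"
  shows "analytic_in T' (g ` A)"
proof -
  obtain S :: "(nat \<Rightarrow> nat) set" and f
    where "closed S" "continuous_map (top_of_set S) T f" "A = f ` S"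
    using assms(1) by (rule analytic_inE)
  then show ?thesis
    using continuous_map_compose[OF _ assms(2)] by (intro analytic_inI[of S T' "g \<circ> f"]) auto
qed

lemma analytic_in_Int_closedin:
  assumes "analytic_in T A" "closedin T C"
  shows "analytic_in T (A \<inter> C)"
proof -
  obtain S :: "(nat \<Rightarrow> nat) set" and f
    where S: "closed S" "continuous_map (top_of_set S) T f" "A = f ` S"
    using assms(1) by (rule analytic_inE)
  have "closedin (top_of_set S) {z \<in> S. f z \<in> C}"
    using closedin_continuous_map_preimage[OF S(2) assms(2)] by simp
  then have "closed {z \<in> S. f z \<in> C}"
    using S(1) closedin_closed_trans by blast
  moreover have "continuous_map (top_of_set {z \<in> S. f z \<in> C}) T f"
    using continuous_map_from_subtopology_mono[OF S(2)] by auto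
  ultimately show ?thesis
    by (rule analytic_inI) (use S(3) in auto)
qed

text \<open>The first entry of a parameter selects the piece and the tail is a parameter for it. As
  the sets \<open>{z. z 0 = n}\<close> are clopen, closedness and continuity can be checked piece by
  piece.\<close>

lemma analytic_in_UN:
  assumes "\<And>n::nat. analytic_in T (A n)"
  shows "analytic_in T (\<Union>n. A n)"
proof -
  have "\<forall>n. \<exists>(S :: (nat \<Rightarrow> nat) set) f.
      closed S \<and> continuous_map (top_of_set S) T f \<and> A n = f ` S"
    using assms unfolding analytic_in_def by blast
  then obtain S :: "nat \<Rightarrow> (nat \<Rightarrow> nat) set" and f where
    S: "\<And>n. closed (S n)" and f: "\<And>n. continuous_map (top_of_set (S n)) T (f n)"
    and A: "\<And>n. A n = f n ` S n"
    by metis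
  define tl' :: "(nat \<Rightarrow> nat) \<Rightarrow> nat \<Rightarrow> nat" where "tl' z = (\<lambda>k. z (Suc k))" for z
  define S' where "S' = {z. tl' z \<in> S (z 0)}"
  define F where "F z = f (z 0) (tl' z)" for z
  have head: "open {z :: nat \<Rightarrow> nat. z 0 = n}" "open {z :: nat \<Rightarrow> nat. z 0 \<noteq> n}" for n
    using open_vimage[OF _ continuous_on_product_coordinates[of 0], of "{n}"]
      open_vimage[OF _ continuous_on_product_coordinates[of 0], of "- {n}"]
    by (auto simp: vimage_def open_discrete)
  have "S' = (\<Inter>n. {z. z 0 \<noteq> n} \<union> {z. tl' z \<in> S n})"
    by (auto simp: S'_def)
  moreover have "closed ({z. z 0 \<noteq> n} \<union> {z. tl' z \<in> S n})" for n
    using head(1)[of n] closed_reindex_vimage[OF S[of n], of Suc]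
    by (intro closed_Un) (auto simp: tl'_def closed_def Collect_neg_eq)
  ultimately have "closed S'"
    by auto
  moreover have "continuous_map (top_of_set S') T F"
    unfolding continuous_map_def
  proof (intro conjI allI impI)
    show "F \<in> topspace (top_of_set S') \<rightarrow> topspace T"
      using continuous_map_image_subset_topspace[OF f] by (fastforce simp: F_def S'_def)
    fix U assume U: "openin T U"
    have "openin (top_of_set (S n)) {z \<in> S n. f n z \<in> U}" for n
      using openin_continuous_map_preimage[OF f U, of n] by simp
    then have "\<forall>n. \<exists>O'. open O' \<and> {z \<in> S n. f n z \<in> U} = S n \<inter> O'"
      by (simp add: openin_open)
    then obtain O' where O': "\<And>n. open (O' n)" "\<And>n. {z \<in> S n. f n z \<in> U} = S n \<inter> O' n"
      by metis
    have "open {z. tl' z \<in> O' n}" for n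
      using open_vimage[OF O'(1) continuous_on_reindex[of UNIV Suc]] by (simp add: vimage_def tl'_def)
    then have "open (\<Union>n. {z. z 0 = n} \<inter> {z. tl' z \<in> O' n})"
      using head by auto
    moreover have "{z \<in> S'. F z \<in> U} = S' \<inter> (\<Union>n. {z. z 0 = n} \<inter> {z. tl' z \<in> O' n})"
    proof -
      have "tl' z \<in> S (z 0) \<Longrightarrow> f (z 0) (tl' z) \<in> U \<longleftrightarrow> tl' z \<in> O' (z 0)" for z
        using O'(2)[of "z 0"] by blast
      then show ?thesis
        by (auto simp: S'_def F_def)
    qed
    ultimately show "openin (top_of_set S') {x \<in> topspace (top_of_set S'). F x \<in> U}"
      by (auto simp: openin_open)
  qed
  moreover have "(\<Union>n. A n) = F ` S'"
  proof (intro set_eqI iffI)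
    fix x assume "x \<in> (\<Union>n. A n)"
    then obtain n z where z: "z \<in> S n" "x = f n z"
      using A by blast
    have "case_nat n z \<in> S'" "x = F (case_nat n z)"
      using z by (simp_all add: S'_def F_def tl'_def)
    then show "x \<in> F ` S'"
      by blast
  next
    fix x assume "x \<in> F ` S'"
    then show "x \<in> (\<Union>n. A n)"
      using A by (auto simp: S'_def F_def)
  qed
  ultimately show ?thesis
    by (rule analytic_inI)
qed

lemma closedin_equaliser:
  assumes "Hausdorff_space T" "continuous_map X T f" "continuous_map X T g"
  shows "closedin X {x \<in> topspace X. f x = g x}"
proof -
  have "continuous_map X (prod_topology T T) (\<lambda>x. (f x, g x))"
    using assms(2,3) by (simp add: continuous_map_pairedI)
  then have "closedin X {x \<in> topspace X. (f x, g x) \<in> (\<lambda>x. (x, x)) ` topspace T}"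
    using assms(1) by (intro closedin_continuous_map_preimage) (auto simp: Hausdorff_space_closedin_diagonal)
  moreover have "{x \<in> topspace X. (f x, g x) \<in> (\<lambda>x. (x, x)) ` topspace T} = {x \<in> topspace X. f x = g x}"
    using continuous_map_image_subset_topspace[OF assms(2)] by auto
  ultimately show ?thesis
    by simp
qed

text \<open>A parameter is read as a matrix whose n-th row is a parameter for \<open>A n\<close>.
  That all rows name the same point is a closed condition because \<open>T\<close> is
  Hausdorff.\<close>

lemma analytic_in_INT:
  assumes T: "Hausdorff_space T" and "\<And>n::nat. analytic_in T (A n)"
  shows "analytic_in T (\<Inter>n. A n)"
proof -
  have "\<forall>n. \<exists>(S :: (nat \<Rightarrow> nat) set) f.
      closed S \<and> continuous_map (top_of_set S) T f \<and> A n = f ` S"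
    using assms unfolding analytic_in_def by blast
  then obtain S :: "nat \<Rightarrow> (nat \<Rightarrow> nat) set" and f where
    S: "\<And>n. closed (S n)" and f: "\<And>n. continuous_map (top_of_set (S n)) T (f n)"
    and A: "\<And>n. A n = f n ` S n"
    by metis
  define row :: "nat \<Rightarrow> (nat \<Rightarrow> nat) \<Rightarrow> nat \<Rightarrow> nat"
    where "row n z = (\<lambda>k. z (prod_encode (n, k)))" for n z
  define S' where "S' = (\<Inter>n. {z. row n z \<in> S n})"
  define S'' where "S'' = (\<Inter>n. {z \<in> S'. f n (row n z) = f 0 (row 0 z)})"
  have cl: "closed S'"
    unfolding S'_def row_def using S by (intro closed_INT ballI closed_reindex_vimage) auto
  have cont: "continuous_map (top_of_set S') T (\<lambda>z. f n (row n z))" for n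
    unfolding row_def by (rule continuous_map_reindex[OF f]) (auto simp: S'_def row_def)
  have "closed {z \<in> S'. f n (row n z) = f 0 (row 0 z)}" for n
    using closedin_equaliser[OF T cont[of n] cont[of 0]] closedin_closed_trans[OF _ cl] by simp
  then have "closed S''"
    unfolding S''_def by blast
  moreover have "continuous_map (top_of_set S'') T (\<lambda>z. f 0 (row 0 z))"
    by (rule continuous_map_from_subtopology_mono[OF cont]) (auto simp: S''_def)
  moreover have "(\<Inter>n. A n) = (\<lambda>z. f 0 (row 0 z)) ` S''"
  proof (intro set_eqI iffI)
    fix x assume "x \<in> (\<Inter>n. A n)"
    then have "\<forall>n. \<exists>z. z \<in> S n \<and> x = f n z"
      using A by blast
    then obtain z where z: "\<And>n. z n \<in> S n" "\<And>n. x = f n (z n)"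
      by metis
    define w where "w = (\<lambda>i. case prod_decode i of (n, k) \<Rightarrow> z n k)"
    have "row n w = z n" for n
      by (auto simp: row_def w_def)
    then have "w \<in> S''" "x = f 0 (row 0 w)"
      using z by (simp_all add: S''_def S'_def flip: z(2))
    then show "x \<in> (\<lambda>z. f 0 (row 0 z)) ` S''"
      by blast
  next
    fix x assume "x \<in> (\<lambda>z. f 0 (row 0 z)) ` S''"
    then obtain z where z: "z \<in> S''" "x = f 0 (row 0 z)"
      by blast
    have "f n (row n z) = x" "row n z \<in> S n" for n
      using z by (auto simp: S''_def S'_def)
    then have "x \<in> A n" for n
      unfolding A by (metis imageI)
    then show "x \<in> (\<Inter>n. A n)"
      by blast
  qed
  ultimately show ?thesis
    by (rule analytic_inI)
qed

lemma analytic_in_Un: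
  assumes "analytic_in T A" "analytic_in T B"
  shows "analytic_in T (A \<union> B)"
proof -
  have "analytic_in T (\<Union>n::nat. if n = 0 then A else B)"
    using assms by (intro analytic_in_UN) auto
  moreover have "(\<Union>n::nat. if n = 0 then A else B) = A \<union> B"
    by (auto split: if_splits)
  ultimately show ?thesis
    by simp
qed

lemma analytic_in_Int:
  assumes "Hausdorff_space T" "analytic_in T A" "analytic_in T B"
  shows "analytic_in T (A \<inter> B)"
proof -
  have "analytic_in T (\<Inter>n::nat. if n = 0 then A else B)"
    using assms by (intro analytic_in_INT) auto
  moreover have "(\<Inter>n::nat. if n = 0 then A else B) = A \<inter> B"
    by (auto split: if_splits dest: spec[of _ 0] spec[of _ 1])
  ultimately show ?thesis
    by simp
qed

lemma analytic_in_countable_Union: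
  assumes "countable I" "\<And>i. i \<in> I \<Longrightarrow> analytic_in T (A i)"
  shows "analytic_in T (\<Union>i\<in>I. A i)"
proof (cases "I = {}")
  case False
  have "analytic_in T (\<Union>n. A (from_nat_into I n))"
    using assms(2) from_nat_into[OF False] by (intro analytic_in_UN) auto
  moreover have "(\<Union>n. A (from_nat_into I n)) = (\<Union>i\<in>I. A i)"
    using range_from_nat_into[OF False assms(1)] by (metis image_image)
  ultimately show ?thesis
    by simp
qed auto

lemma analytic_in_Times:
  assumes "analytic_in T A" "analytic_in T' B"
  shows "analytic_in (prod_topology T T') (A \<times> B)"
proof -
  obtain S :: "(nat \<Rightarrow> nat) set" and f
    where S: "closed S" "continuous_map (top_of_set S) T f" "A = f ` S"
    using assms(1) by (rule analytic_inE)
  obtain S' :: "(nat \<Rightarrow> nat) set" and f'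
    where S': "closed S'" "continuous_map (top_of_set S') T' f'" "B = f' ` S'"
    using assms(2) by (rule analytic_inE)
  define e where "e z = (\<lambda>k. z (2 * k))" for z :: "nat \<Rightarrow> nat"
  define o' where "o' z = (\<lambda>k. z (Suc (2 * k)))" for z :: "nat \<Rightarrow> nat"
  define Q where "Q = {z. e z \<in> S} \<inter> {z. o' z \<in> S'}"
  have "closed Q"
    unfolding Q_def e_def o'_def by (intro closed_Int closed_reindex_vimage S(1) S'(1))
  moreover have "continuous_map (top_of_set Q) (prod_topology T T') (\<lambda>z. (f (e z), f' (o' z)))"
    unfolding e_def o'_def
    by (intro continuous_map_pairedI continuous_map_reindex[OF S(2)] continuous_map_reindex[OF S'(2)])
      (auto simp: Q_def e_def o'_def)
  moreover have "A \<times> B = (\<lambda>z. (f (e z), f' (o' z))) ` Q"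
  proof (intro set_eqI iffI)
    fix p assume "p \<in> A \<times> B"
    then obtain z z' where z: "z \<in> S" "z' \<in> S'" "p = (f z, f' z')"
      using S(3) S'(3) by blast
    define w where "w = (\<lambda>i. if even i then z (i div 2) else z' (i div 2))"
    have "e w = z" "o' w = z'"
      by (auto simp: e_def o'_def w_def)
    then show "p \<in> (\<lambda>z. (f (e z), f' (o' z))) ` Q"
      using z by (intro image_eqI[of _ _ w]) (auto simp: Q_def)
  qed (auto simp: S(3) S'(3) Q_def)
  ultimately show ?thesis
    by (rule analytic_inI)
qed

lemma analytic_in_Borel:
  assumes T: "metrizable_space T" "analytic_in T (topspace T)"
    and B: "B \<in> sigma_sets (topspace T) {U. openin T U}"
  shows "analytic_in T B"
proof -
  have cl: "analytic_in T C" if "closedin T C" for C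
    using analytic_in_Int_closedin[OF T(2) that] closedin_subset[OF that] by (simp add: Int_absorb1)
  have op: "analytic_in T U" if U: "openin T U" for U
  proof -
    have "fsigma_in T U"
      using open_imp_fsigma_in[OF T(1) U] .
    then obtain C :: "nat \<Rightarrow> 'a set" where "\<And>n. closedin T (C n)" "(\<Union>n. C n) = U"
      unfolding fsigma_in_ascending by blast
    then show ?thesis
      using analytic_in_UN[of T C] cl by metis
  qed
  \<comment> \<open>Analytic sets are not closed under complements, so the induction carries the set
    and its complement together.\<close>
  have "analytic_in T B \<and> analytic_in T (topspace T - B)"
    using B
  proof induction
    case (Basic U)
    then show ?case
      using op cl[OF openin_closedin_eq[THEN iffD1, THEN conjunct2]] by auto
  next
    case Empty
    then show ?case
      using T(2) by simp
  next
    case (Compl U)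
    moreover have "U \<subseteq> topspace T"
      using Compl(2) analytic_in_subset by blast
    ultimately show ?case
      by (simp add: double_diff)
  next
    case (Union U)
    have "topspace T - (\<Union>n. U n) = (\<Inter>n. topspace T - U n)"
      by auto
    then show ?case
      using Union(2) analytic_in_UN[of T U] analytic_in_INT[of T "\<lambda>n. topspace T - U n"]
        metrizable_imp_Hausdorff_space[OF T(1)] by simp
  qed
  then show ?thesis ..
qed

text \<open>A non-separable sequence of images of cylinders stays non-separable after some refinement of
  any one of the cylinders; the resulting branches \<open>y n\<close> have to be mapped to different points, and
  those are separated by open sets.\<close>

theorem Novikov_separation:
  assumes an: "\<And>n::nat. analytic_in T (A n)" and disj: "(\<Inter>n. A n) = {}"
    and N: "space N = topspace T"
    and sep: "\<And>p q. p \<in> topspace T \<Longrightarrow> q \<in> topspace T \<Longrightarrow> p \<noteq> q \<Longrightarrow>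
      \<exists>U W. openin T U \<and> openin T W \<and> U \<in> sets N \<and> W \<in> sets N \<and> p \<in> U \<and> q \<in> W \<and> U \<inter> W = {}"
  obtains B where "\<And>n. B n \<in> sets N" "\<And>n. A n \<subseteq> B n" "(\<Inter>n. B n) = {}"
proof -
  have "\<forall>n. \<exists>(S :: (nat \<Rightarrow> nat) set) f.
      closed S \<and> continuous_map (top_of_set S) T f \<and> A n = f ` S"
    using an unfolding analytic_in_def by blast
  then obtain S :: "nat \<Rightarrow> (nat \<Rightarrow> nat) set" and f where
    S: "\<And>n. closed (S n)" and f: "\<And>n. continuous_map (top_of_set (S n)) T (f n)"
    and A: "\<And>n. A n = f n ` S n"
    by metis
  have f_space: "f n z \<in> topspace T" if "z \<in> S n" for n z
    using continuous_map_image_subset_topspace[OF f] that by fastforce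
  define separated where "separated Q \<longleftrightarrow>
    (\<exists>B. (\<forall>n. B n \<in> sets N \<and> Q n \<subseteq> B n) \<and> (\<Inter>n. B n) = {})" for Q :: "nat \<Rightarrow> 'a set"
  \<comment> \<open>Entry number \<open>prod_encode (n, i)\<close> of \<open>s\<close> prescribes
    coordinate \<open>i\<close> of the n-th parameter. One word thus describes a cylinder for every
    \<open>n\<close>, and appending a letter refines exactly one of them.\<close>
  define Q where "Q s n = f n ` {z \<in> S n. \<forall>i. prod_encode (n, i) < length s \<longrightarrow>
      z i = s ! prod_encode (n, i)}" for s n
  have Q_space: "Q s n \<subseteq> space N" for s n
    using f_space by (auto simp: Q_def N)
  have refine: "\<exists>k. \<not> separated (Q (s @ [k]))" if "\<not> separated (Q s)" for s
  proof (rule ccontr)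
    assume "\<nexists>k. \<not> separated (Q (s @ [k]))"
    then have "\<forall>k. \<exists>B. (\<forall>n. B n \<in> sets N \<and> Q (s @ [k]) n \<subseteq> B n) \<and> (\<Inter>n. B n) = {}"
      by (simp add: separated_def)
    then obtain B where B: "\<And>k n. B k n \<in> sets N" "\<And>k n. Q (s @ [k]) n \<subseteq> B k n"
      "\<And>k. (\<Inter>n. B k n) = {}"
      by metis
    obtain n0 i0 where ni: "prod_decode (length s) = (n0, i0)"
      by fastforce
    then have ni': "prod_encode (n0, i0) = length s"
      by (metis prod_decode_inverse)
    \<comment> \<open>Only the n0-th image is split by the new letter, so there the hulls are
      united. The other images are the same for all \<open>k\<close>, so their hulls may be
      intersected; a point of all \<open>B' n\<close> then lies in all \<open>B k n\<close> for a
      single \<open>k\<close>.\<close>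
    define B' where "B' n = (if n = n0 then (\<Union>k. B k n) else (\<Inter>k. B k n))" for n
    have "Q s n \<subseteq> B' n" for n
    proof (cases "n = n0")
      case True
      have "Q s n0 \<subseteq> (\<Union>k. Q (s @ [k]) n0)"
      proof
        fix x assume "x \<in> Q s n0"
        then obtain z where "z \<in> S n0" "x = f n0 z"
          "\<And>i. prod_encode (n0, i) < length s \<Longrightarrow> z i = s ! prod_encode (n0, i)"
          by (auto simp: Q_def)
        then have "x \<in> Q (s @ [z i0]) n0"
          using ni' by (auto simp: Q_def nth_append less_Suc_eq prod_encode_eq intro!: image_eqI[of _ _ z])
            (metis Pair_inject prod_encode_eq)
        then show "x \<in> (\<Union>k. Q (s @ [k]) n0)"
          by blast
      qed
      then show ?thesis
        using B(2) True by (fastforce simp: B'_def)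
    next
      case False
      have "prod_encode (n, i) \<noteq> length s" for i
        using False ni' by (metis prod.inject prod_encode_eq)
      then have "Q s n \<subseteq> Q (s @ [k]) n" for k
        by (auto simp: Q_def nth_append less_Suc_eq)
      then show ?thesis
        using B(2) False by (fastforce simp: B'_def)
    qed
    moreover have "B' n \<in> sets N" for n
      using B(1) by (auto simp: B'_def)
    moreover have "(\<Inter>n. B' n) = {}"
    proof (rule equals0I)
      fix x assume x: "x \<in> (\<Inter>n. B' n)"
      then have "x \<in> B' n0"
        by blast
      then obtain k where k: "x \<in> B k n0"
        by (auto simp: B'_def)
      have "x \<in> B k n" for n
        using x k by (cases "n = n0") (auto simp: B'_def dest!: spec[of _ n])
      then show False
        using B(3)[of k] by blast
    qed
    ultimately show False
      using that unfolding separated_def by blast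
  qed
  have "separated (Q [])"
  proof (rule ccontr)
    assume "\<not> separated (Q [])"
    then have "\<exists>s. \<not> separated (Q s) \<and> length s = 0"
      by auto
    moreover have "\<exists>s'. (\<not> separated (Q s') \<and> length s' = Suc n) \<and> (\<exists>k. s' = s @ [k])"
      if "\<not> separated (Q s) \<and> length s = n" for s n
      using refine[of s] that by auto
    ultimately obtain s where s: "\<And>j. \<not> separated (Q (s j))" "\<And>j. length (s j) = j"
      "\<And>j. \<exists>k. s (Suc j) = s j @ [k]"
      using dependent_nat_choice[of "\<lambda>n s. \<not> separated (Q s) \<and> length s = n" "\<lambda>n s s'. \<exists>k. s' = s @ [k]"]
      by metis
    define Y where "Y j = s (Suc j) ! j" for j
    have Y: "s j ! i = Y i" if "i < j" for i j
      using that
    proof (induction j)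
      case (Suc j)
      obtain k where "s (Suc j) = s j @ [k]"
        using s(3) by blast
      then show ?case
        using Suc s(2)[of j] by (cases "i = j") (auto simp: Y_def nth_append)
    qed simp
    define y where "y n = (\<lambda>i. Y (prod_encode (n, i)))" for n
    \<comment> \<open>The codes of the first \<open>m\<close> coordinates of the n-th branch lie
      below some \<open>j\<close>; from then on the word \<open>s j\<close> fixes all of
      them.\<close>
    have small: "\<exists>j. \<forall>j'\<ge>j. Q (s j') n \<subseteq> f n ` {z \<in> S n. \<forall>i<m. z i = y n i}" for n m
    proof -
      obtain j where j: "\<And>i. i < m \<Longrightarrow> prod_encode (n, i) < j"
        using finite_nat_set_iff_bounded[of "(\<lambda>i. prod_encode (n, i)) ` {..<m}"] by auto
      have "z i = y n i" if "j' \<ge> j" "i < m" "\<forall>i. prod_encode (n, i) < length (s j') \<longrightarrow>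
          z i = s j' ! prod_encode (n, i)" for j' z i
        using that j[OF that(2)] Y[of "prod_encode (n, i)" j'] s(2)[of j'] by (auto simp: y_def)
      then show ?thesis
        unfolding Q_def by (intro exI[of _ j]) blast
    qed
    \<comment> \<open>Otherwise a cylinder around \<open>y n\<close> misses the closed set
      \<open>S n\<close>, some \<open>Q (s j) n\<close> is empty, and the empty set together with
      whole spaces separates.\<close>
    have yS: "y n \<in> S n" for n
    proof (rule ccontr)
      assume "y n \<notin> S n"
      then obtain m where m: "\<And>z. (\<And>i. i < m \<Longrightarrow> z i = y n i) \<Longrightarrow> z \<in> - S n"
        using open_contains_cylinder[of "- S n" "y n"] S[of n] by (auto simp: closed_def)
      then have "{z \<in> S n. \<forall>i<m. z i = y n i} = {}"
        by blast
      then obtain j where "Q (s j) n = {}"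
        using small[of n m] by (metis image_empty order_refl subset_empty)
      then have "separated (Q (s j))"
        unfolding separated_def using Q_space
        by (intro exI[of _ "\<lambda>i. if i = n then {} else space N"]) auto
      then show False
        using s(1) by blast
    qed
    obtain n where n: "f n (y n) \<noteq> f 0 (y 0)"
    proof (rule ccontr)
      assume "\<not> thesis"
      then have "f n (y n) = f 0 (y 0)" for n
        using that by blast
      then have "f 0 (y 0) \<in> A n" for n
        using yS[of n] A[of n] by (metis imageI)
      then show False
        using disj by blast
    qed
    then obtain U W where UW: "openin T U" "openin T W" "U \<in> sets N" "W \<in> sets N"
      "f n (y n) \<in> U" "f 0 (y 0) \<in> W" "U \<inter> W = {}"
      using sep[of "f n (y n)" "f 0 (y 0)"] f_space[OF yS] by blast
    have nbhd: "\<exists>j. \<forall>j'\<ge>j. Q (s j') i \<subseteq> O'" if O': "openin T O'" "f i (y i) \<in> O'" for i O'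
    proof -
      have "openin (top_of_set (S i)) {z \<in> S i. f i z \<in> O'}"
        using openin_continuous_map_preimage[OF f O'(1), of i] by simp
      then obtain O'' where O'': "open O''" "{z \<in> S i. f i z \<in> O'} = S i \<inter> O''"
        by (auto simp: openin_open)
      have "y i \<in> O''"
        using O''(2) yS[of i] O'(2) by blast
      then obtain m where m: "\<And>z. (\<And>k. k < m \<Longrightarrow> z k = y i k) \<Longrightarrow> z \<in> O''"
        using open_contains_cylinder[OF O''(1)] by blast
      then have "f i ` {z \<in> S i. \<forall>k<m. z k = y i k} \<subseteq> O'"
        using O''(2) by blast
      then show ?thesis
        using small[of i m] by blast
    qed
    obtain j1 j2 where j: "\<And>j'. j' \<ge> j1 \<Longrightarrow> Q (s j') n \<subseteq> U" "\<And>j'. j' \<ge> j2 \<Longrightarrow> Q (s j') 0 \<subseteq> W"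
      using nbhd[OF UW(1,5)] nbhd[OF UW(2,6)] by blast
    have "n \<noteq> 0"
      using n by metis
    have "separated (Q (s (max j1 j2)))"
      unfolding separated_def
    proof (intro exI[of _ "\<lambda>i. if i = n then U else if i = 0 then W else space N"] conjI allI)
      show "(\<Inter>i. if i = n then U else if i = 0 then W else space N) = {}"
      proof (rule equals0I)
        fix x assume "x \<in> (\<Inter>i. if i = n then U else if i = 0 then W else space N)"
        from INT_D[OF this, of n] INT_D[OF this, of 0] show False
          using \<open>n \<noteq> 0\<close> UW(7) by auto
      qed
    qed (use UW j[of "max j1 j2"] Q_space in auto)
    then show False
      using s(1) by blast
  qed
  then obtain B where "\<And>n. B n \<in> sets N \<and> Q [] n \<subseteq> B n" "(\<Inter>n. B n) = {}"
    unfolding separated_def by blast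
  moreover have "Q [] n = A n" for n
    by (simp add: Q_def A)
  ultimately show thesis
    using that[of B] by simp
qed

text \<open>The sequence \<open>A, A', A', ...\<close> is separated: a point of \<open>A'\<close>
  lies in every \<open>B n\<close> with \<open>n\<close> positive, hence not in
  \<open>B 0\<close>.\<close>

corollary Lusin_separation:
  assumes "analytic_in T A" "analytic_in T A'" "A \<inter> A' = {}" "space N = topspace T"
    and "\<And>p q. p \<in> topspace T \<Longrightarrow> q \<in> topspace T \<Longrightarrow> p \<noteq> q \<Longrightarrow>
      \<exists>U W. openin T U \<and> openin T W \<and> U \<in> sets N \<and> W \<in> sets N \<and> p \<in> U \<and> q \<in> W \<and> U \<inter> W = {}"
  obtains B where "B \<in> sets N" "A \<subseteq> B" "B \<inter> A' = {}"
proof -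
  define Q where "Q n = (if n = 0 then A else A')" for n :: nat
  have "analytic_in T (Q n)" for n
    using assms by (auto simp: Q_def)
  moreover have "(\<Inter>n. Q n) \<subseteq> Q 0 \<inter> Q 1"
    by blast
  then have "(\<Inter>n. Q n) = {}"
    using assms(3) by (auto simp: Q_def)
  ultimately obtain B where B: "\<And>n. B n \<in> sets N" "\<And>n. Q n \<subseteq> B n" "(\<Inter>n. B n) = {}"
    by (rule Novikov_separation[of T Q N]) (use assms(4,5) in blast)+
  have "B 0 \<inter> A' = {}"
  proof (rule equals0I)
    fix x assume x: "x \<in> B 0 \<inter> A'"
    then have "x \<in> B n" for n
      using B(2)[of n] by (cases n) (auto simp: Q_def)
    then show False
      using B(3) by blast
  qed
  then show thesis
    using that[of "B 0"] B(1,2)[of 0] by (simp add: Q_def)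
qed

section \<open>Polish spaces\<close>

context Metric_space
begin

text \<open>A sequence of indices names the limit of the corresponding dense points. Restricting to
  sequences whose n-th step has size at most \<open>(1/2) ^ n\<close> gives all of them the same
  rate of convergence, which makes the limit map continuous.\<close>

lemma analytic_in_complete_separable:
  assumes complete: mcomplete and D: "range D \<subseteq> M"
    and dense: "\<forall>x\<in>M. \<forall>e>0. \<exists>n::nat. d x (D n) < e"
  shows "analytic_in mtopology M"
proof -
  have DM: "D n \<in> M" for n
    using D by auto
  define S where "S = {z. \<forall>n. d (D (z n)) (D (z (Suc n))) \<le> (1/2) ^ n}"
  have "openin (top_of_set UNIV) (- S)"
  proof (rule openin_cylinderI)
    fix y assume "y \<in> - S"
    then obtain n where n: "\<not> d (D (y n)) (D (y (Suc n))) \<le> (1/2) ^ n"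
      by (auto simp: S_def)
    have "z \<in> - S" if "\<forall>i<Suc (Suc n). z i = y i" for z
      using that n unfolding S_def by (metis (mono_tags, lifting) ComplI lessI less_SucI mem_Collect_eq)
    then show "\<exists>m. \<forall>z\<in>UNIV. (\<forall>i<m. z i = y i) \<longrightarrow> z \<in> - S"
      by blast
  qed auto
  then have "closed S"
    by (simp add: closed_def)
  \<comment> \<open>The exact value of the partial geometric sum is what the induction reproduces;
    the subtracted term is dropped only in \<open>tail'\<close>.\<close>
  have tail: "d (D (z n)) (D (z (n + k))) \<le> 2 * (1/2) ^ n - 2 * (1/2) ^ (n + k)" if "z \<in> S" for z n k
  proof (induction k)
    case (Suc k)
    have "d (D (z n)) (D (z (n + Suc k))) \<le> d (D (z n)) (D (z (n + k))) + d (D (z (n + k))) (D (z (Suc (n + k))))"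
      using triangle[OF DM DM DM] by simp
    also have "\<dots> \<le> 2 * (1/2) ^ n - 2 * (1/2) ^ (n + k) + (1/2) ^ (n + k)"
      using Suc that by (intro add_mono) (auto simp: S_def)
    finally show ?case
      by simp
  qed (simp add: DM)
  have tail': "d (D (z n)) (D (z m)) \<le> 2 * (1/2) ^ n" if "z \<in> S" "n \<le> m" for z n m
  proof -
    have "d (D (z n)) (D (z (n + (m - n)))) \<le> 2 * (1/2) ^ n - 2 * (1/2) ^ (n + (m - n))"
      by (rule tail[OF that(1)])
    moreover have "(0::real) \<le> 2 * (1/2) ^ (n + (m - n))"
      by simp
    ultimately show ?thesis
      using that(2) by (simp only: le_add_diff_inverse)
  qed
  have pow_small: "\<exists>n. c * (1/2) ^ n < e" if "e > 0" "c > 0" for c e :: real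
    using real_arch_pow_inv[of "e / c" "1/2"] that by (auto simp: field_simps)
  have "\<exists>x\<in>M. \<forall>n. d (D (z n)) x \<le> 2 * (1/2) ^ n" if z: "z \<in> S" for z
  proof -
    have "MCauchy (\<lambda>n. D (z n))"
      unfolding MCauchy_def
    proof (intro conjI allI impI)
      show "range (\<lambda>n. D (z n)) \<subseteq> M"
        using D by auto
      fix e :: real assume "e > 0"
      then obtain N where N: "4 * (1/2) ^ N < e"
        using pow_small[of e 4] by auto
      have "d (D (z n)) (D (z n')) < e" if "N \<le> n" "N \<le> n'" for n n'
        using triangle[OF DM[of "z n"] DM[of "z N"] DM[of "z n'"]] tail'[OF z that(1)] tail'[OF z that(2)] N
        by (simp add: commute)
      then show "\<exists>N. \<forall>n n'. N \<le> n \<longrightarrow> N \<le> n' \<longrightarrow> d (D (z n)) (D (z n')) < e"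
        by blast
    qed
    then obtain x where x: "limitin mtopology (\<lambda>n. D (z n)) x sequentially"
      using complete unfolding mcomplete_def by blast
    then have "x \<in> M"
      using limitin_mspace by blast
    moreover have "d (D (z n)) x \<le> 2 * (1/2) ^ n" for n
    proof (rule field_le_epsilon)
      fix e :: real assume "e > 0"
      then obtain N where N: "\<And>m. m \<ge> N \<Longrightarrow> d (D (z m)) x < e"
        using x unfolding limit_metric_sequentially by blast
      show "d (D (z n)) x \<le> 2 * (1/2) ^ n + e"
        using triangle[OF DM[of "z n"] DM[of "z (max n N)"] \<open>x \<in> M\<close>] tail'[OF z, of n "max n N"] N[of "max n N"]
        by simp
    qed
    ultimately show ?thesis
      by blast
  qed
  then obtain f where f: "\<And>z. z \<in> S \<Longrightarrow> f z \<in> M" "\<And>z n. z \<in> S \<Longrightarrow> d (D (z n)) (f z) \<le> 2 * (1/2) ^ n"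
    by metis
  have "continuous_map (top_of_set S) mtopology f"
    unfolding continuous_map_def
  proof (intro conjI allI impI)
    show "f \<in> topspace (top_of_set S) \<rightarrow> topspace mtopology"
      using f(1) by auto
    fix U assume U: "openin mtopology U"
    have "openin (top_of_set S) {z \<in> S. f z \<in> U}"
    proof (rule openin_cylinderI)
      fix y assume y: "y \<in> {z \<in> S. f z \<in> U}"
      then obtain e where e: "e > 0" "mball (f y) e \<subseteq> U"
        using U unfolding openin_mtopology by blast
      then obtain n where n: "4 * (1/2) ^ n < e"
        using pow_small[of e 4] by auto
      have "f z \<in> U" if z: "z \<in> S" "\<forall>i<Suc n. z i = y i" for z
      proof -
        have "z n = y n"
          using z by auto
        then have "d (f y) (f z) < e"
          using triangle[OF f(1)[of y] DM[of "y n"] f(1)[of z]] f(2)[of y n] f(2)[of z n] y z n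
          by (simp add: commute)
        then show ?thesis
          using e y z f(1) by auto
      qed
      then show "\<exists>m. \<forall>z\<in>S. (\<forall>i<m. z i = y i) \<longrightarrow> z \<in> {z \<in> S. f z \<in> U}"
        by blast
    qed auto
    then show "openin (top_of_set S) {x \<in> topspace (top_of_set S). f x \<in> U}"
      by simp
  qed
  moreover have "M = f ` S"
  proof (intro set_eqI iffI)
    fix x assume x: "x \<in> M"
    have "\<exists>k. d x (D k) < (1/2) ^ n / 2" for n
      by (rule dense[rule_format, OF x]) simp
    then obtain z where z: "\<And>n. d x (D (z n)) < (1/2) ^ n / 2"
      by metis
    have "d (D (z n)) (D (z (Suc n))) \<le> (1/2) ^ n" for n
    proof -
      have "d (D (z n)) (D (z (Suc n))) \<le> d x (D (z n)) + d x (D (z (Suc n)))"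
        using triangle[OF DM[of "z n"] x DM[of "z (Suc n)"]] by (simp add: commute)
      moreover have "(0::real) < (1/2) ^ n" "(1/2) ^ Suc n = (1/2) ^ n / (2::real)"
        by simp_all
      ultimately show ?thesis
        using z[of n] z[of "Suc n"] by linarith
    qed
    then have "z \<in> S"
      by (simp add: S_def)
    have "d x (f z) \<le> 0"
    proof (rule field_le_epsilon)
      fix e :: real assume "e > 0"
      then obtain n where n: "3 * (1/2) ^ n < e"
        using pow_small[of e 3] by auto
      have "(0::real) < (1/2) ^ n"
        by simp
      then show "d x (f z) \<le> 0 + e"
        using triangle[OF x DM[of "z n"] f(1)[OF \<open>z \<in> S\<close>]] z[of n] f(2)[OF \<open>z \<in> S\<close>, of n] n by linarith
    qed
    then have "x = f z"
      using x f(1)[OF \<open>z \<in> S\<close>] by (meson nonneg order_antisym zero)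
    then show "x \<in> f ` S"
      using \<open>z \<in> S\<close> by blast
  qed (use f(1) in auto)
  ultimately show ?thesis
    using analytic_inI[OF \<open>closed S\<close>] by blast
qed

text \<open>The index also carries the size: its second component \<open>k\<close> stands for radius
  \<open>1 / (k + 1)\<close>, so that "arbitrarily small" becomes a condition on indices.\<close>

definition rational_ball :: "(nat \<Rightarrow> 'a) \<Rightarrow> nat \<Rightarrow> 'a set" where
  "rational_ball D n = mball (D (fst (prod_decode n))) (1 / real (Suc (snd (prod_decode n))))"

lemma inverse_Suc_small: "e > 0 \<Longrightarrow> \<exists>k0. \<forall>k\<ge>k0. c / real (Suc k) < e" for c e :: real
proof -
  assume "e > 0"
  obtain k0 where k0: "c / e < real k0"
    using reals_Archimedean2 by blast
  have "c / real (Suc k) < e" if "k \<ge> k0" for k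
  proof -
    have "c / e < real (Suc k)"
      using k0 that by linarith
    then show ?thesis
      using \<open>e > 0\<close> by (simp add: field_simps)
  qed
  then show ?thesis
    by blast
qed

lemma rational_ball_base:
  assumes "range D \<subseteq> M" and dense: "\<forall>x\<in>M. \<forall>e>0. \<exists>n::nat. d x (D n) < e"
    and x: "x \<in> M" "e > 0"
  shows "\<exists>n. x \<in> rational_ball D n \<and> rational_ball D n \<subseteq> mball x e \<and> snd (prod_decode n) \<ge> k"
proof -
  obtain k0 where k0: "\<And>k. k \<ge> k0 \<Longrightarrow> 2 / real (Suc k) < e"
    using inverse_Suc_small[OF x(2)] by blast
  define k' where "k' = max k k0"
  obtain i where i: "d x (D i) < 1 / real (Suc k')"
    using dense[rule_format, OF x(1), of "1 / real (Suc k')"] by auto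
  have Di: "D i \<in> M"
    using assms(1) by auto
  have "mball (D i) (1 / real (Suc k')) \<subseteq> mball x e"
  proof
    fix y assume "y \<in> mball (D i) (1 / real (Suc k'))"
    then have y: "y \<in> M" "d (D i) y < 1 / real (Suc k')"
      by auto
    have "2 / real (Suc k') < e"
      by (rule k0) (simp add: k'_def)
    moreover have "2 / real (Suc k') = 1 / real (Suc k') + 1 / real (Suc k')"
      by simp
    ultimately have "d x y < e"
      using triangle[OF x(1) Di y(1)] i y(2) by linarith
    then show "y \<in> mball x e"
      using x y by simp
  qed
  moreover have "x \<in> mball (D i) (1 / real (Suc k'))"
    using i x Di by (simp add: commute)
  ultimately show ?thesis
    by (intro exI[of _ "prod_encode (i, k')"]) (auto simp: rational_ball_def k'_def simp del: in_mball)
qed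

text \<open>All quantifiers on the right-hand side range over natural numbers, so the sets of basic
  open sets that are the neighbourhoods of a point form a Borel family.\<close>

lemma point_code_iff:
  assumes complete: mcomplete and D: "range D \<subseteq> M"
    and dense: "\<forall>x\<in>M. \<forall>e>0. \<exists>n::nat. d x (D n) < e"
  shows "(\<exists>y\<in>M. \<forall>n. P n \<longleftrightarrow> y \<in> rational_ball D n) \<longleftrightarrow>
    (\<forall>k. \<exists>n. P n \<and> snd (prod_decode n) \<ge> k) \<and>
    (\<forall>n m. P n \<longrightarrow> P m \<longrightarrow> rational_ball D n \<inter> rational_ball D m \<noteq> {}) \<and>
    (\<forall>n. P n \<longrightarrow> (\<exists>m. P m \<and> mtopology closure_of (rational_ball D m) \<subseteq> rational_ball D n)) \<and>
    (\<forall>n m. P m \<longrightarrow> rational_ball D m \<subseteq> rational_ball D n \<longrightarrow> P n)"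
    (is "?L \<longleftrightarrow> ?small \<and> ?meet \<and> ?clos \<and> ?up")
proof
  assume ?L
  then obtain y where y: "y \<in> M" and P: "\<And>n. P n \<longleftrightarrow> y \<in> rational_ball D n"
    by blast
  have ?small
    using rational_ball_base[OF D dense y zero_less_one] P by blast
  moreover have ?meet
    using P by blast
  moreover have ?clos
  proof (intro allI impI)
    fix n assume "P n"
    then have "openin mtopology (rational_ball D n)" "y \<in> rational_ball D n"
      using P by (auto simp: rational_ball_def)
    then obtain e where e: "e > 0" "mcball y e \<subseteq> rational_ball D n"
      unfolding openin_mtopology_mcball by blast
    obtain m where "y \<in> rational_ball D m" "rational_ball D m \<subseteq> mball y e"
      using rational_ball_base[OF D dense y e(1)] by blast
    moreover have "mtopology closure_of (mball y e) \<subseteq> mcball y e"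
      by (rule closure_of_minimal) auto
    ultimately show "\<exists>m. P m \<and> mtopology closure_of (rational_ball D m) \<subseteq> rational_ball D n"
      using P e(2) closure_of_mono by (meson subset_trans)
  qed
  moreover have ?up
    using P by blast
  ultimately show "?small \<and> ?meet \<and> ?clos \<and> ?up"
    by blast
next
  assume "?small \<and> ?meet \<and> ?clos \<and> ?up"
  then have small: ?small and meet: ?meet and clos: ?clos and up: ?up
    by blast+
  \<comment> \<open>One ball of radius at most \<open>1 / (k + 1)\<close> for each \<open>k\<close>;
    any two of them meet, so their centres form a Cauchy sequence.\<close>
  obtain n where n: "\<And>k. P (n k)" "\<And>k. snd (prod_decode (n k)) \<ge> k"
    using small by metis
  define p where "p k = D (fst (prod_decode (n k)))" for k
  have pM: "p k \<in> M" for k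
    using D by (auto simp: p_def)
  have ball: "rational_ball D (n k) \<subseteq> mball (p k) (1 / real (Suc k))" for k
    unfolding rational_ball_def p_def using n(2)[of k]
    by (intro mball_subset_concentric) (simp add: field_simps)
  have near: "d (p k) (p j) < 1 / real (Suc k) + 1 / real (Suc j)" for k j
  proof -
    obtain q where "q \<in> rational_ball D (n k)" "q \<in> rational_ball D (n j)"
      using meet n(1) by blast
    then have "q \<in> M" "d (p k) q < 1 / real (Suc k)" "d (p j) q < 1 / real (Suc j)"
      using ball[of k] ball[of j] by auto
    then show ?thesis
      using triangle[OF pM[of k], of q "p j"] pM[of j] by (simp add: commute)
  qed
  have "MCauchy p"
    unfolding MCauchy_def
  proof (intro conjI allI impI)
    show "range p \<subseteq> M"
      using pM by auto
    fix e :: real assume "e > 0"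
    then have "e / 2 > 0"
      by simp
    then obtain k0 where "\<And>k. k \<ge> k0 \<Longrightarrow> 1 / real (Suc k) < e / 2"
      using inverse_Suc_small by metis
    then have "d (p k) (p j) < e" if "k \<ge> k0" "j \<ge> k0" for k j
      using near[of k j] that by (smt (verit, best) field_sum_of_halves)
    then show "\<exists>N. \<forall>n n'. N \<le> n \<longrightarrow> N \<le> n' \<longrightarrow> d (p n) (p n') < e"
      by blast
  qed
  then obtain y where y: "limitin mtopology p y sequentially"
    using complete unfolding mcomplete_def by blast
  then have yM: "y \<in> M"
    using limitin_mspace by blast
  have py: "d (p k) y \<le> 1 / real (Suc k)" for k
  proof (rule field_le_epsilon)
    fix e :: real assume "e > 0"
    then have "e / 2 > 0"
      by simp
    then obtain k0 where k0: "\<And>k. k \<ge> k0 \<Longrightarrow> 1 / real (Suc k) < e / 2"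
      using inverse_Suc_small by metis
    obtain N where N: "\<And>m. m \<ge> N \<Longrightarrow> d (p m) y < e / 2"
      using y \<open>e / 2 > 0\<close> unfolding limit_metric_sequentially by blast
    show "d (p k) y \<le> 1 / real (Suc k) + e"
      using triangle[OF pM[of k] pM[of "max k0 N"] yM] near[of k "max k0 N"] N[of "max k0 N"]
        k0[of "max k0 N"] by simp
  qed
  have ball_y: "d y q < 2 / real (Suc k)" if "q \<in> rational_ball D (n k)" for q k
  proof -
    have "q \<in> M" "d (p k) q < 1 / real (Suc k)"
      using that ball[of k] by auto
    then show ?thesis
      using triangle[OF yM pM[of k]] py[of k] by (smt (verit, best) add_divide_distrib commute)
  qed
  have "P i \<longleftrightarrow> y \<in> rational_ball D i" for i
  proof
    assume "P i"
    \<comment> \<open>The limit \<open>y\<close> is only known to adhere to every ball satisfying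
      \<open>P\<close>. Passing to a ball whose closure lies inside the given one turns adherence
      into membership.\<close>
    then obtain m where m: "P m" "mtopology closure_of (rational_ball D m) \<subseteq> rational_ball D i"
      using clos by blast
    have "y \<in> mtopology closure_of (rational_ball D m)"
      unfolding metric_closure_of
    proof (safe intro!: yM)
      fix e :: real assume "e > 0"
      then obtain k where k: "2 / real (Suc k) < e"
        using inverse_Suc_small by blast
      obtain q where q: "q \<in> rational_ball D m" "q \<in> rational_ball D (n k)"
        using meet m(1) n(1) by blast
      then have "q \<in> M"
        using ball[of k] by auto
      then show "\<exists>q\<in>rational_ball D m. q \<in> mball y e"
        using q ball_y[OF q(2)] k yM by auto
    qed
    then show "y \<in> rational_ball D i"
      using m(2) by blast
  next
    assume "y \<in> rational_ball D i"
    moreover have "openin mtopology (rational_ball D i)"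
      by (simp add: rational_ball_def)
    ultimately obtain e where e: "e > 0" "mball y e \<subseteq> rational_ball D i"
      unfolding openin_mtopology by blast
    then obtain k where k: "2 / real (Suc k) < e"
      using inverse_Suc_small by blast
    have "rational_ball D (n k) \<subseteq> mball y e"
    proof
      fix q assume q: "q \<in> rational_ball D (n k)"
      then have "q \<in> M"
        using ball[of k] by auto
      then show "q \<in> mball y e"
        using ball_y[OF q] k yM by auto
    qed
    then show "P i"
      using up n(1)[of k] e(2) by blast
  qed
  then show ?L
    using yM by blast
qed

end

text \<open>These are the facts the later arguments take from the metric. Besides
  \<open>analytic\<close>, completeness survives in \<open>code\<close>: it is a Borel test for
  whether the memberships of \<open>x\<close> in the sets \<open>C n\<close> are the memberships of
  some actual point in the sets \<open>U n\<close>.\<close>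

locale polish_base =
  fixes M :: "'a measure" and X :: "'a topology" and U :: "nat \<Rightarrow> 'a set"
  assumes metrizable: "metrizable_space X"
    and analytic: "analytic_in X (topspace X)"
    and topspace: "topspace X = space M"
    and sets_eq: "sets M = sigma_sets (space M) {U. openin X U}"
    and open_U: "\<And>n. openin X (U n)"
    and base: "\<And>O' x. openin X O' \<Longrightarrow> x \<in> O' \<Longrightarrow> \<exists>n. x \<in> U n \<and> U n \<subseteq> O'"
    and code: "\<And>C. (\<And>n. C n \<in> sets M) \<Longrightarrow>
      {x \<in> space M. \<exists>y\<in>space M. \<forall>n. x \<in> C n \<longleftrightarrow> y \<in> U n} \<in> sets M"

lemma standard_borel_imp_polish_base:
  assumes "standard_borel M"
  obtains X U where "polish_base M X U"
proof -
  obtain X where X: "completely_metrizable_space X" "separable_space X" "topspace X = space M"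
    "sets M = sigma_sets (space M) {U. openin X U}"
    using assms unfolding standard_borel_def by blast
  obtain M' d where d: "Metric_space M' d" "Metric_space.mcomplete M' d" "X = Metric_space.mtopology M' d"
    using X(1) unfolding completely_metrizable_space_def by blast
  interpret Metric_space M' d
    by fact
  have M': "M' = space M"
    using X(3) d(3) by simp
  have metr: "metrizable_space X"
    using X(1) completely_metrizable_imp_metrizable_space by blast
  obtain C where C: "countable C" "C \<subseteq> M'" "X closure_of C = M'"
    using X(2) d(3) unfolding separable_space_def by auto
  show thesis
  proof (cases "M' = {}")
    case True
    then have "openin X V \<Longrightarrow> V = {}" for V
      using openin_subset[of X V] X(3) M' by simp
    then have "polish_base M X (\<lambda>_. {})"
      using metr X(3,4) True M' by unfold_locales auto
    then show thesis
      by (rule that)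
  next
    case False
    then have "C \<noteq> {}"
      using C(3) by auto
    define D where "D = from_nat_into C"
    have rangeD: "range D = C"
      using C(1) \<open>C \<noteq> {}\<close> by (simp add: D_def)
    have D: "range D \<subseteq> M'"
      using rangeD C(2) by simp
    have dense: "\<forall>x\<in>M'. \<forall>e>0. \<exists>n. d x (D n) < e"
    proof (intro ballI allI impI)
      fix x and e :: real assume x: "x \<in> M'" "e > 0"
      have "x \<in> mtopology closure_of C"
        using C(3) d(3) x(1) by simp
      then obtain q where "q \<in> C" "q \<in> mball x e"
        using \<open>e > 0\<close> unfolding metric_closure_of by blast
      moreover obtain n where "q = D n"
        using rangeD \<open>q \<in> C\<close> by blast
      ultimately show "\<exists>n. d x (D n) < e"
        by auto
    qed
    have op: "openin X (rational_ball D n)" for n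
      by (simp add: rational_ball_def d(3))
    have "polish_base M X (rational_ball D)"
    proof
      show "analytic_in X (topspace X)"
        using analytic_in_complete_separable[OF d(2) D dense] d(3) by simp
      show "\<exists>n. x \<in> rational_ball D n \<and> rational_ball D n \<subseteq> O'" if O': "openin X O'" "x \<in> O'" for O' x
      proof -
        have "openin mtopology O'"
          using O'(1) d(3) by simp
        then have "O' \<subseteq> M'" "\<exists>e>0. mball x e \<subseteq> O'"
          using O'(2) unfolding openin_mtopology by blast+
        then obtain e where e: "e > 0" "mball x e \<subseteq> O'" "x \<in> M'"
          using O'(2) by blast
        then show ?thesis
          using rational_ball_base[OF D dense e(3,1)] by blast
      qed
      fix C :: "nat \<Rightarrow> 'a set" assume [measurable]: "\<And>n. C n \<in> sets M"
      have [measurable]: "Measurable.pred M (\<lambda>x. x \<in> C n)" for n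
        by measurable
      have "Measurable.pred M (\<lambda>x. \<exists>y\<in>M'. \<forall>n. x \<in> C n \<longleftrightarrow> y \<in> rational_ball D n)"
        unfolding point_code_iff[OF d(2) D dense] by measurable
      then show "{x \<in> space M. \<exists>y\<in>space M. \<forall>n. x \<in> C n \<longleftrightarrow> y \<in> rational_ball D n} \<in> sets M"
        by (simp add: M' pred_def)
    qed (use metr X op in auto)
    then show thesis
      by (rule that)
  qed
qed

section \<open>Borel sets with finite sections\<close>

context polish_base
begin

lemma U_sets [measurable]: "U n \<in> sets M"
  unfolding sets_eq using open_U by (intro sigma_sets.Basic) simp

lemma U_subset: "U n \<subseteq> space M"
  using openin_subset[OF open_U] topspace by simp

lemma Hausdorff: "Hausdorff_space X"
  using metrizable by (rule metrizable_imp_Hausdorff_space)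

lemma U_separates:
  assumes "p \<in> space M" "q \<in> space M" "p \<noteq> q"
  shows "\<exists>i j. p \<in> U i \<and> q \<in> U j \<and> U i \<inter> U j = {}"
proof -
  obtain A B where "openin X A" "openin X B" "p \<in> A" "q \<in> B" "disjnt A B"
    using Hausdorff assms topspace unfolding Hausdorff_space_def by metis
  then show ?thesis
    using base[of A p] base[of B q] by (metis disjnt_def disjnt_subset1 disjnt_subset2)
qed

lemma U_isolates:
  assumes "finite F" "F \<subseteq> space M" "y \<in> space M"
  shows "\<exists>n. y \<in> U n \<and> U n \<inter> F \<subseteq> {y}"
proof -
  have "closedin X (F - {y})"
    using assms topspace by (intro closedin_Hausdorff_finite[OF Hausdorff]) auto
  then have "openin X (space M - (F - {y}))"
    using topspace by (metis openin_closedin_eq openin_diff openin_topspace)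
  then show ?thesis
    using base[of "space M - (F - {y})" y] assms(3) by auto
qed

lemma measurable_via_base:
  assumes "f \<in> space N \<rightarrow> space M" "\<And>n. f -` U n \<inter> space N \<in> sets N"
  shows "f \<in> N \<rightarrow>\<^sub>M M"
proof (rule measurable_sigma_sets[OF sets_eq _ assms(1)])
  show "{U. openin X U} \<subseteq> Pow (space M)"
    using openin_subset topspace by auto
  fix V assume "V \<in> {U. openin X U}"
  then have "f x \<in> V \<longleftrightarrow> (\<exists>n. U n \<subseteq> V \<and> f x \<in> U n)" for x
    using base[of V] by blast
  then have "f -` V \<inter> space N = (\<Union>n\<in>{n. U n \<subseteq> V}. f -` U n \<inter> space N)"
    by auto
  then show "f -` V \<inter> space N \<in> sets N"
    using sets.countable_UN''[of "{n. U n \<subseteq> V}" "\<lambda>n. f -` U n \<inter> space N" N] assms(2) by simp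
qed

text \<open>Both projections are measurable for the Borel sets of the product topology, so these
  contain the product sigma-algebra and \<open>analytic_in_Borel\<close> applies.\<close>

lemma pair_sets_analytic:
  assumes "B \<in> sets (M \<Otimes>\<^sub>M M)"
  shows "analytic_in (prod_topology X X) B"
proof (rule analytic_in_Borel)
  show "metrizable_space (prod_topology X X)"
    using metrizable by (simp add: metrizable_space_prod_topology)
  show "analytic_in (prod_topology X X) (topspace (prod_topology X X))"
    using analytic_in_Times[OF analytic analytic] by simp
  define Bor where "Bor = sigma (space M \<times> space M) {V. openin (prod_topology X X) V}"
  have sub: "{V. openin (prod_topology X X) V} \<subseteq> Pow (space M \<times> space M)"
    using openin_subset[of "prod_topology X X"] topspace by auto
  have space_Bor: "space Bor = space M \<times> space M"
    using sub by (simp add: Bor_def)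
  have sets_Bor: "sets Bor = sigma_sets (space M \<times> space M) {V. openin (prod_topology X X) V}"
    using sub by (simp add: Bor_def)
  have "fst \<in> Bor \<rightarrow>\<^sub>M M"
  proof (rule measurable_via_base)
    fix n
    have "fst -` U n \<inter> space Bor = U n \<times> topspace X"
      using U_subset by (auto simp: space_Bor topspace)
    then show "fst -` U n \<inter> space Bor \<in> sets Bor"
      unfolding sets_Bor by (intro sigma_sets.Basic) (simp add: openin_prod_Times_iff open_U)
  qed (auto simp: space_Bor)
  moreover have "snd \<in> Bor \<rightarrow>\<^sub>M M"
  proof (rule measurable_via_base)
    fix n
    have "snd -` U n \<inter> space Bor = topspace X \<times> U n"
      using U_subset by (auto simp: space_Bor topspace)
    then show "snd -` U n \<inter> space Bor \<in> sets Bor"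
      unfolding sets_Bor by (intro sigma_sets.Basic) (simp add: openin_prod_Times_iff open_U)
  qed (auto simp: space_Bor)
  ultimately have "(\<lambda>p. (fst p, snd p)) \<in> Bor \<rightarrow>\<^sub>M M \<Otimes>\<^sub>M M"
    by (rule measurable_Pair)
  from measurable_sets[OF this assms] have "B \<inter> space Bor \<in> sets Bor"
    by simp
  moreover have "B \<subseteq> space Bor"
    using sets.sets_into_space[OF assms] by (simp add: space_pair_measure space_Bor)
  ultimately show "B \<in> sigma_sets (topspace (prod_topology X X)) {U. openin (prod_topology X X) U}"
    using sets_Bor by (simp add: Int_absorb2 topspace)
qed

lemma projection_analytic:
  assumes "B \<in> sets (M \<Otimes>\<^sub>M M)"
  shows "analytic_in X (fst ` B)"
  using analytic_in_continuous_image[OF pair_sets_analytic[OF assms] continuous_map_fst] .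

text \<open>The points with a value in \<open>U n\<close> and those with a value outside form two
  analytic sets, disjoint by single-valuedness. A Borel set \<open>C n\<close> separates them, and
  the value at \<open>x\<close> is the only point whose memberships in the \<open>U n\<close> agree
  with those of \<open>x\<close> in the \<open>C n\<close>.\<close>

lemma Borel_function_of_single_valued:
  assumes F: "F \<in> sets (M \<Otimes>\<^sub>M M)" and fn: "single_valued F"
  obtains g where "g \<in> M \<rightarrow>\<^sub>M M" "\<And>x y. (x, y) \<in> F \<Longrightarrow> g x = y"
proof -
  have F_sub: "F \<subseteq> space M \<times> space M"
    using sets.sets_into_space[OF F] by (simp add: space_pair_measure)
  have "\<exists>C. C \<in> sets M \<and> fst ` (F \<inter> space M \<times> U n) \<subseteq> C \<and>
      C \<inter> fst ` (F \<inter> space M \<times> (space M - U n)) = {}" for n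
  proof -
    have "analytic_in X (fst ` (F \<inter> space M \<times> U n))"
      using F by (intro projection_analytic) auto
    moreover have "analytic_in X (fst ` (F \<inter> space M \<times> (space M - U n)))"
      using F by (intro projection_analytic) auto
    moreover have "fst ` (F \<inter> space M \<times> U n) \<inter> fst ` (F \<inter> space M \<times> (space M - U n)) = {}"
      using single_valuedD[OF fn] by fastforce
    ultimately show ?thesis
      by (rule Lusin_separation[of X _ _ M])
        (use topspace U_separates open_U U_sets in \<open>metis|blast\<close>)+
  qed
  then obtain C where C: "\<And>n. C n \<in> sets M" "\<And>n. fst ` (F \<inter> space M \<times> U n) \<subseteq> C n"
    "\<And>n. C n \<inter> fst ` (F \<inter> space M \<times> (space M - U n)) = {}"
    by metis
  define is_code where "is_code x y \<longleftrightarrow> y \<in> space M \<and> (\<forall>n. x \<in> C n \<longleftrightarrow> y \<in> U n)" for x y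
  have is_code_unique: "y = y'" if "is_code x y" "is_code x y'" for x y y'
    using that U_separates[of y y'] unfolding is_code_def by (metis disjoint_iff)
  define dom where "dom = {x \<in> space M. \<exists>y\<in>space M. \<forall>n. x \<in> C n \<longleftrightarrow> y \<in> U n}"
  have [measurable]: "dom \<in> sets M"
    unfolding dom_def using C(1) by (rule code)
  \<comment> \<open>Where the memberships in the \<open>C n\<close> code no point, the identity is a
    measurable default that stays in the space. It needs \<open>dom\<close> to be Borel, which is
    what \<open>code\<close> provides.\<close>
  define g where "g x = (if x \<in> dom then SOME y. is_code x y else x)" for x
  have g: "is_code x (g x)" if "x \<in> dom" for x
  proof -
    have "\<exists>y. is_code x y"
      using that by (auto simp: dom_def is_code_def)
    then show ?thesis
      using that someI_ex[of "is_code x"] by (simp add: g_def)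
  qed
  have "g \<in> M \<rightarrow>\<^sub>M M"
  proof (rule measurable_via_base)
    have "g x \<in> space M" if "x \<in> space M" for x
    proof (cases "x \<in> dom")
      case True
      then show ?thesis
        using g by (simp add: is_code_def)
    next
      case False
      then show ?thesis
        using that by (simp add: g_def)
    qed
    then show "g \<in> space M \<rightarrow> space M"
      by simp
    fix n
    have "g -` U n \<inter> space M = (dom \<inter> C n) \<union> (space M - dom) \<inter> U n"
    proof (intro set_eqI)
      fix x
      show "x \<in> g -` U n \<inter> space M \<longleftrightarrow> x \<in> (dom \<inter> C n) \<union> (space M - dom) \<inter> U n"
      proof (cases "x \<in> dom")
        case True
        then show ?thesis
          using g[OF True] by (auto simp: is_code_def dom_def)
      next
        case False
        then show ?thesis
          by (auto simp: g_def)
      qed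
    qed
    then show "g -` U n \<inter> space M \<in> sets M"
      using C(1) by auto
  qed
  moreover have "g x = y" if "(x, y) \<in> F" for x y
  proof -
    have xy: "x \<in> space M" "y \<in> space M"
      using that F_sub by auto
    have "x \<in> C n \<longleftrightarrow> y \<in> U n" for n
    proof (cases "y \<in> U n")
      case True
      then have "x \<in> fst ` (F \<inter> space M \<times> U n)"
        using that xy by force
      then show ?thesis
        using C(2) True by blast
    next
      case False
      then have "x \<in> fst ` (F \<inter> space M \<times> (space M - U n))"
        using that xy by force
      then show ?thesis
        using C(3) False by blast
    qed
    then have "is_code x y"
      using xy by (simp add: is_code_def)
    moreover have "x \<in> dom"
      using xy \<open>is_code x y\<close> by (auto simp: dom_def is_code_def)
    ultimately show ?thesis
      using g is_code_unique by blast
  qed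
  ultimately show thesis
    using that by blast
qed

text \<open>\<open>A n\<close> collects the pairs \<open>(x, y)\<close> of \<open>E\<close> for
  which \<open>U n\<close> fails to isolate \<open>y\<close> in the section of \<open>x\<close>.
  Finiteness gives each pair an isolating \<open>U n\<close>, so the \<open>A n\<close> have no
  common point; off a Borel hull \<open>B n\<close> of \<open>A n\<close>, the set
  \<open>U n\<close> contains \<open>y\<close> and no other point of the section, so
  \<open>E - B n\<close> is single-valued.\<close>

theorem Lusin_Novikov_finite_sections:
  assumes E: "E \<in> sets (M \<Otimes>\<^sub>M M)" and fin: "\<And>x. x \<in> space M \<Longrightarrow> finite (E `` {x})"
  obtains g :: "nat \<Rightarrow> 'a \<Rightarrow> 'a" where "\<And>n. g n \<in> M \<rightarrow>\<^sub>M M"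
    "\<And>n x. x \<in> space M \<Longrightarrow> g n x = x \<or> (x, g n x) \<in> E"
    "\<And>x y. (x, y) \<in> E \<Longrightarrow> \<exists>n. g n x = y"
proof -
  have E_sub: "E \<subseteq> space M \<times> space M"
    using sets.sets_into_space[OF E] by (simp add: space_pair_measure)
  define P where "P V = fst ` (E \<inter> space M \<times> V)" for V
  have P: "analytic_in X (P V)" if "V \<in> sets M" for V
    unfolding P_def using E that by (intro projection_analytic) auto
  define I where "I = {(i, j). U i \<inter> U j = {}}"
  \<comment> \<open>\<open>H n\<close> says that the section of \<open>x\<close> has two distinct
    points in \<open>U n\<close>. Distinctness is witnessed by disjoint basic open sets, so only
    countably many projections are involved.\<close>
  define H where "H n = (\<Union>ij\<in>I. P (U n \<inter> U (fst ij)) \<inter> P (U n \<inter> U (snd ij)))" for n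
  have H: "analytic_in X (H n)" for n
    unfolding H_def by (intro analytic_in_countable_Union analytic_in_Int Hausdorff P) auto
  define A where "A n = (E \<inter> space M \<times> (space M - U n)) \<union> (E \<inter> H n \<times> space M)" for n
  have HsM: "Hausdorff_space (prod_topology X X)"
    using Hausdorff by (simp add: Hausdorff_space_prod_topology)
  have A: "analytic_in (prod_topology X X) (A n)" for n
  proof -
    have "E \<inter> space M \<times> (space M - U n) \<in> sets (M \<Otimes>\<^sub>M M)"
      using E by auto
    moreover have "analytic_in (prod_topology X X) (H n \<times> space M)"
      using analytic_in_Times[OF H analytic] by (simp add: topspace)
    ultimately show ?thesis
      unfolding A_def
      by (intro analytic_in_Un pair_sets_analytic[of "E \<inter> space M \<times> (space M - U n)"]
          analytic_in_Int[OF HsM pair_sets_analytic[OF E]])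
  qed
  have "(\<Inter>n. A n) = {}"
  proof (rule equals0I, clarify)
    fix x y assume xy: "(x, y) \<in> (\<Inter>n. A n)"
    then have "(x, y) \<in> E"
      by (auto simp: A_def)
    then have sp: "x \<in> space M" "y \<in> space M" "E `` {x} \<subseteq> space M"
      using E_sub by auto
    then obtain n where n: "y \<in> U n" "U n \<inter> E `` {x} \<subseteq> {y}"
      using U_isolates[OF fin] by blast
    have "x \<notin> H n"
    proof
      assume "x \<in> H n"
      then obtain i j z z' where "U i \<inter> U j = {}" "(x, z) \<in> E" "z \<in> U n \<inter> U i"
        "(x, z') \<in> E" "z' \<in> U n \<inter> U j"
        by (fastforce simp: H_def I_def P_def)
      then show False
        using n by blast
    qed
    then show False
      using xy n(1) by (auto simp: A_def)
  qed
  then obtain B where B: "\<And>n. B n \<in> sets (M \<Otimes>\<^sub>M M)" "\<And>n. A n \<subseteq> B n" "(\<Inter>n. B n) = {}"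
  proof (rule Novikov_separation[OF A])
    show "space (M \<Otimes>\<^sub>M M) = topspace (prod_topology X X)"
      by (simp add: space_pair_measure topspace)
    \<comment> \<open>Distinct pairs differ in a coordinate, and a strip over a basic open set is
      both open in the product and measurable.\<close>
    fix p q assume pq: "p \<in> topspace (prod_topology X X)" "q \<in> topspace (prod_topology X X)" "p \<noteq> q"
    obtain p1 p2 q1 q2 where [simp]: "p = (p1, p2)" "q = (q1, q2)"
      by fastforce
    have mem: "p1 \<in> space M" "p2 \<in> space M" "q1 \<in> space M" "q2 \<in> space M"
      using pq(1,2) topspace by auto
    have op_space: "openin X (space M)"
      using openin_topspace[of X] topspace by simp
    consider "p1 \<noteq> q1" | "p2 \<noteq> q2"
      using pq(3) by auto
    then show "\<exists>U W. openin (prod_topology X X) U \<and> openin (prod_topology X X) W \<and>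
      U \<in> sets (M \<Otimes>\<^sub>M M) \<and> W \<in> sets (M \<Otimes>\<^sub>M M) \<and> p \<in> U \<and> q \<in> W \<and> U \<inter> W = {}"
    proof cases
      case 1
      then obtain i j where "p1 \<in> U i" "q1 \<in> U j" "U i \<inter> U j = {}"
        using U_separates mem by meson
      then show ?thesis
        using mem by (intro exI[of _ "U i \<times> space M"] exI[of _ "U j \<times> space M"])
          (simp_all add: openin_prod_Times_iff open_U op_space Times_Int_Times)
    next
      case 2
      then obtain i j where "p2 \<in> U i" "q2 \<in> U j" "U i \<inter> U j = {}"
        using U_separates mem by meson
      then show ?thesis
        using mem by (intro exI[of _ "space M \<times> U i"] exI[of _ "space M \<times> U j"])
          (simp_all add: openin_prod_Times_iff open_U op_space Times_Int_Times)
    qed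
  next
    fix B assume "\<And>n. B n \<in> sets (M \<Otimes>\<^sub>M M)" "\<And>n. A n \<subseteq> B n" "(\<Inter>n. B n) = {}"
    then show thesis
      by (rule that)
  qed
  have F: "E - B n \<in> sets (M \<Otimes>\<^sub>M M)" for n
    using E B(1) by auto
  have fn: "single_valued (E - B n)" for n
  proof (rule single_valuedI, rule ccontr)
    fix x y y' assume that: "(x, y) \<in> E - B n" "(x, y') \<in> E - B n"
    assume "y \<noteq> y'"
    have not_A: "(x, y) \<notin> A n" "(x, y') \<notin> A n"
      using that B(2) by blast+
    have mem: "x \<in> space M" "y \<in> space M" "y' \<in> space M"
      using that E_sub by auto
    then have "y \<in> U n" "y' \<in> U n"
      using not_A that by (auto simp: A_def)
    obtain i j where ij: "y \<in> U i" "y' \<in> U j" "(i, j) \<in> I"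
      using U_separates[OF mem(2,3) \<open>y \<noteq> y'\<close>] by (auto simp: I_def)
    have in_P: "x \<in> P V" if "(x, z) \<in> E" "z \<in> V" for z V
      unfolding P_def using that mem by force
    have "x \<in> P (U n \<inter> U i)" "x \<in> P (U n \<inter> U j)"
      using that ij \<open>y \<in> U n\<close> \<open>y' \<in> U n\<close> in_P[of y] in_P[of y'] by simp_all
    then have "x \<in> H n"
      using ij(3) by (force simp: H_def)
    then show False
      using not_A that mem by (auto simp: A_def)
  qed
  have "\<exists>g. g \<in> M \<rightarrow>\<^sub>M M \<and> (\<forall>x y. (x, y) \<in> E - B n \<longrightarrow> g x = y)" for n
    using Borel_function_of_single_valued[OF F fn] by metis
  then obtain h where h: "\<And>n. h n \<in> M \<rightarrow>\<^sub>M M" "\<And>n x y. (x, y) \<in> E - B n \<Longrightarrow> h n x = y"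
    by metis
  note [measurable] = h(1)
  \<comment> \<open>Off the graph it extends, \<open>h n\<close> is arbitrary and may leave
    \<open>E\<close>; there the value falls back on \<open>x\<close>.\<close>
  define g where "g n x = (if (x, h n x) \<in> E then h n x else x)" for n x
  show thesis
  proof
    fix n
    have [measurable]: "Measurable.pred M (\<lambda>x. (x, h n x) \<in> E)"
      using E by measurable
    show "g n \<in> M \<rightarrow>\<^sub>M M"
      unfolding g_def by measurable
    show "g n x = x \<or> (x, g n x) \<in> E" for x
      by (simp add: g_def)
  next
    fix x y assume "(x, y) \<in> E"
    moreover obtain n where "(x, y) \<notin> B n"
      using B(3) by blast
    ultimately have "g n x = y"
      using h(2)[of x y n] by (auto simp: g_def)
    then show "\<exists>n. g n x = y" ..
  qed
qed

end

section \<open>Locally finite Borel graphs\<close>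

lemma gball_iff: "y \<in> gball V E t x \<longleftrightarrow> y \<in> V \<and> (\<exists>n\<le>t. (x, y) \<in> E ^^ n)"
proof -
  have "gdist E x y \<le> enat t \<longleftrightarrow> (\<exists>n\<le>t. (x, y) \<in> E ^^ n)"
  proof
    assume le: "gdist E x y \<le> enat t"
    show "\<exists>n\<le>t. (x, y) \<in> E ^^ n"
    proof (rule ccontr)
      assume "\<not> ?thesis"
      then have "enat (Suc t) \<le> gdist E x y"
        unfolding gdist_def by (intro INF_greatest) (auto simp: not_le Suc_le_eq)
      then have "enat (Suc t) \<le> enat t"
        using le by (rule order_trans)
      then show False
        by simp
    qed
  next
    assume "\<exists>n\<le>t. (x, y) \<in> E ^^ n"
    then obtain n where n: "n \<le> t" "(x, y) \<in> E ^^ n"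
      by blast
    then have "gdist E x y \<le> enat n"
      unfolding gdist_def by (intro INF_lower) simp
    then show "gdist E x y \<le> enat t"
      using n(1) by (meson enat_ord_simps(1) order_trans)
  qed
  then show ?thesis
    by (simp add: gball_def)
qed

lemma gball_mono: "t \<le> t' \<Longrightarrow> gball V E t x \<subseteq> gball V E t' x"
  by (auto simp: gball_iff) (meson order_trans)

lemma gball_subset: "gball V E t x \<subseteq> V"
  by (auto simp: gball_iff)

lemma gball_space: "y \<in> gball V E t x \<Longrightarrow> y \<in> V"
  by (simp add: gball_iff)

lemma gball_self: "x \<in> V \<Longrightarrow> x \<in> gball V E t x"
  by (auto simp: gball_iff intro!: exI[of _ 0])

lemma gball_trans: "y \<in> gball V E s x \<Longrightarrow> z \<in> gball V E t y \<Longrightarrow> z \<in> gball V E (s + t) x"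
  unfolding gball_iff by (metis add_mono relcomp.intros relpow_add)

lemma gball_sym:
  assumes "sgraph V E" "x \<in> V" "y \<in> gball V E t x"
  shows "x \<in> gball V E t y"
proof -
  have "(x, y) \<in> E ^^ n \<Longrightarrow> (y, x) \<in> E ^^ n" for n
  proof (induction n arbitrary: y)
    case (Suc n)
    then obtain z where "(x, z) \<in> E ^^ n" "(z, y) \<in> E"
      by auto
    then have "(z, x) \<in> E ^^ n" "(y, z) \<in> E"
      using Suc.IH assms(1) by (auto simp: sgraph_def dest: symD)
    then show ?case
      by (rule relpow_Suc_I2[rotated])
  qed simp
  then show ?thesis
    using assms(2,3) by (auto simp: gball_iff)
qed

lemma finite_gball:
  assumes "locally_finite V E" "sgraph V E" "x \<in> V"
  shows "finite (gball V E t x)"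
proof -
  have "finite ((E ^^ n) `` {x})" for n
  proof (induction n)
    case (Suc n)
    have "(E ^^ n) `` {x} \<subseteq> V"
      using assms(2,3) by (cases n) (auto simp: sgraph_def)
    moreover have "(E ^^ Suc n) `` {x} = (\<Union>y\<in>(E ^^ n) `` {x}. E `` {y})"
      by auto
    ultimately show ?case
      using Suc assms(1) by (auto simp: locally_finite_def)
  qed simp
  then have "finite (\<Union>n\<le>t. (E ^^ n) `` {x})"
    by blast
  moreover have "gball V E t x \<subseteq> (\<Union>n\<le>t. (E ^^ n) `` {x})"
    by (auto simp: gball_iff)
  ultimately show ?thesis
    by (rule finite_subset[rotated])
qed

text \<open>Two vertices of \<open>R\<close> are joined by a walk inside \<open>R\<close> with no
  more steps than there are edges in \<open>R\<close>, and these number at most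
  \<open>r * r\<close>. Any bound depending on \<open>r\<close> alone would serve.\<close>

lemma induced_connected_subset_gball:
  assumes "induced_connected E R" "R \<subseteq> V" "finite R" "card R \<le> r" "x \<in> R"
  shows "R \<subseteq> gball V E (r * r) x"
proof
  fix y assume "y \<in> R"
  then have "(x, y) \<in> (E \<inter> R \<times> R)\<^sup>*"
    using assms by (simp add: induced_connected_def)
  moreover have fin: "finite (E \<inter> R \<times> R)"
    using assms(3) by blast
  ultimately obtain n where n: "n \<le> card (E \<inter> R \<times> R)" "(x, y) \<in> (E \<inter> R \<times> R) ^^ n"
    using rtrancl_finite_eq_relpow[OF fin] by auto
  have "card (E \<inter> R \<times> R) \<le> card (R \<times> R)"
    using assms(3) by (intro card_mono) auto
  also have "\<dots> \<le> r * r"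
    using assms(4) by (simp add: card_cartesian_product mult_le_mono)
  finally have "n \<le> r * r"
    using n(1) by simp
  moreover have "(x, y) \<in> E ^^ n"
    using n(2) by (induction n arbitrary: y) auto
  ultimately show "y \<in> gball V E (r * r) x"
    using \<open>y \<in> R\<close> assms(2) by (auto simp: gball_iff)
qed

lemma local_rule_cong:
  assumes "local_rule t \<R>" "sgraph V E" "x \<in> V" "\<And>y. y \<in> gball V E t x \<Longrightarrow> lam y = lam' y"
  shows "\<R> V E lam x = \<R> V E lam' x"
proof -
  have "rooted_labelled_iso (gball V E t x) E lam x (gball V E t x) E lam' x"
    unfolding rooted_labelled_iso_def using assms(4) by (intro exI[of _ id]) auto
  then show ?thesis
    using assms unfolding local_rule_def by blast
qed

section \<open>Measurability of functions with countably many pieces\<close>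

lemma measurable_piecewise_constant:
  fixes A :: "'i :: countable \<Rightarrow> 'a set"
  assumes "\<And>i. A i \<in> sets M" "space M \<subseteq> (\<Union>i. A i)"
    and "\<And>i x y. x \<in> A i \<Longrightarrow> y \<in> A i \<Longrightarrow> f x = f y"
  shows "f \<in> M \<rightarrow>\<^sub>M count_space UNIV"
proof (rule measurableI)
  fix B
  have "f -` B \<inter> space M = (\<Union>i\<in>{i. \<exists>x\<in>A i. f x \<in> B}. A i)"
  proof (intro set_eqI iffI)
    fix x assume x: "x \<in> f -` B \<inter> space M"
    then obtain i where "x \<in> A i"
      using assms(2) by blast
    then show "x \<in> (\<Union>i\<in>{i. \<exists>x\<in>A i. f x \<in> B}. A i)"
      using x by blast
  next
    fix x assume "x \<in> (\<Union>i\<in>{i. \<exists>x\<in>A i. f x \<in> B}. A i)"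
    then obtain i y where "x \<in> A i" "y \<in> A i" "f y \<in> B"
      by blast
    then show "x \<in> f -` B \<inter> space M"
      using assms(3)[of x i y] sets.sets_into_space[OF assms(1)[of i]] by auto
  qed
  also have "\<dots> \<in> sets M"
    using assms(1) by (intro sets.countable_UN') auto
  finally show "f -` B \<inter> space M \<in> sets M" .
qed simp

lemma measurable_nat_via_pred:
  fixes f :: "'a \<Rightarrow> nat"
  assumes "\<And>n. Measurable.pred M (\<lambda>x. f x = n)"
  shows "f \<in> M \<rightarrow>\<^sub>M count_space UNIV"
proof (rule measurable_piecewise_constant[where A = "\<lambda>n. {x \<in> space M. f x = n}"])
  show "{x \<in> space M. f x = n} \<in> sets M" for n
    using assms[of n] by (simp add: pred_def)
qed auto

text \<open>The orbits of the semigroup generated by the Borel maps \<open>g n\<close> are the connected components, so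
  that quantifiers over vertices become quantifiers over words.\<close>

locale enumerated_graph =
  fixes M :: "'a measure" and E :: "('a \<times> 'a) set" and g :: "nat \<Rightarrow> 'a \<Rightarrow> 'a"
    and U :: "nat \<Rightarrow> 'a set"
  assumes sg: "sgraph (space M) E" and lf: "locally_finite (space M) E"
    and E_sets: "E \<in> sets (M \<Otimes>\<^sub>M M)"
    and g_measurable [measurable]: "\<And>n. g n \<in> M \<rightarrow>\<^sub>M M"
    and g_step: "\<And>n x. x \<in> space M \<Longrightarrow> g n x = x \<or> (x, g n x) \<in> E"
    and g_cover: "\<And>x y. (x, y) \<in> E \<Longrightarrow> \<exists>n. g n x = y"
    and g_id: "\<And>x. g 0 x = x"
    and U_sets [measurable]: "\<And>n. U n \<in> sets M"
    and U_isolates: "\<And>F y. finite F \<Longrightarrow> F \<subseteq> space M \<Longrightarrow> y \<in> space M \<Longrightarrow>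
      \<exists>n. y \<in> U n \<and> U n \<inter> F \<subseteq> {y}"
begin

abbreviation V :: "'a set" where "V \<equiv> space M"

abbreviation cball :: "nat \<Rightarrow> 'a \<Rightarrow> 'a set" where "cball \<equiv> gball V E"

definition act :: "nat list \<Rightarrow> 'a \<Rightarrow> 'a" where "act w = fold g w"

lemma act_simps [simp]: "act [] x = x" "act (n # w) x = act w (g n x)"
  by (simp_all add: act_def)

lemma act_append [simp]: "act (u @ w) x = act w (act u x)"
  by (simp add: act_def)

lemma act_measurable [measurable]: "act w \<in> M \<rightarrow>\<^sub>M M"
proof (induction w)
  case (Cons n w)
  have "(\<lambda>x. act w (g n x)) \<in> M \<rightarrow>\<^sub>M M"
    using Cons by measurable
  moreover have "act (n # w) = (\<lambda>x. act w (g n x))"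
    by auto
  ultimately show ?case
    by simp
qed (simp add: act_def)

lemma act_space: "x \<in> V \<Longrightarrow> act w x \<in> V"
  using measurable_space[OF act_measurable] .

lemma act_in_cball: "x \<in> V \<Longrightarrow> act w x \<in> cball (length w) x"
proof (induction w arbitrary: x)
  case Nil
  then show ?case
    by (simp add: gball_self)
next
  case (Cons n w)
  have gV: "g n x \<in> V"
    using measurable_space[OF g_measurable] Cons.prems .
  have "g n x \<in> cball 1 x"
  proof (cases "g n x = x")
    case True
    then show ?thesis
      using gball_self[of x V E 1] Cons.prems by simp
  next
    case False
    then have "(x, g n x) \<in> E ^^ 1"
      using g_step[OF Cons.prems] by auto
    then show ?thesis
      using gV by (auto simp: gball_iff simp del: relpow_1)
  qed
  then have "act w (g n x) \<in> cball (1 + length w) x"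
    using Cons.IH[OF gV] by (rule gball_trans)
  then show ?case
    by simp
qed

lemma act_replicate_0 [simp]: "act (replicate k 0) x = x"
  by (induction k) (simp_all add: g_id)

text \<open>The letter 0 acts as the identity and pads a shorter walk, so that a ball of radius
  \<open>t\<close> consists of the values of words of length exactly \<open>t\<close>.\<close>

lemma cball_imp_act:
  assumes "y \<in> cball t x"
  shows "\<exists>w. length w = t \<and> act w x = y"
proof -
  obtain n where n: "n \<le> t" "(x, y) \<in> E ^^ n"
    using assms by (auto simp: gball_iff)
  have "(x, y) \<in> E ^^ n \<Longrightarrow> \<exists>w. length w = n \<and> act w x = y" for y
  proof (induction n arbitrary: y)
    case (Suc n)
    then obtain z where z: "(x, z) \<in> E ^^ n" "(z, y) \<in> E"
      by auto
    obtain w k where "length w = n" "act w x = z" "g k z = y"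
      using Suc.IH[OF z(1)] g_cover[OF z(2)] by blast
    then show ?case
      by (intro exI[of _ "w @ [k]"]) simp
  qed simp
  then obtain w where "length w = n" "act w x = y"
    using n(2) by blast
  then show ?thesis
    using n(1) by (intro exI[of _ "w @ replicate (t - n) 0"]) simp
qed

lemma cball_iff_act: "x \<in> V \<Longrightarrow> y \<in> cball t x \<longleftrightarrow> (\<exists>w. length w = t \<and> y = act w x)"
  using cball_imp_act act_in_cball by metis

lemmas cball_sym = gball_sym[OF sg]
lemmas finite_cball = finite_gball[OF lf sg]

lemma act_connected: "x \<in> V \<Longrightarrow> (x, act w x) \<in> connectivity_rel V E"
  using act_in_cball[of x w] act_space[of x w]
  by (auto simp: connectivity_rel_def gball_iff intro: relpow_imp_rtrancl)

text \<open>Equality is decided by the countably many sets \<open>U n\<close>: one of them contains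
  the first point and, unless the points coincide, not the second. Hence a one-sided implication is
  enough.\<close>

lemma pred_act_eq [measurable]: "Measurable.pred M (\<lambda>x. act v x = act w x)"
proof -
  have "act v x = act w x \<longleftrightarrow> (\<forall>n. act v x \<in> U n \<longrightarrow> act w x \<in> U n)" if "x \<in> V" for x
  proof
    assume *: "\<forall>n. act v x \<in> U n \<longrightarrow> act w x \<in> U n"
    obtain n where "act v x \<in> U n" "U n \<inter> {act w x} \<subseteq> {act v x}"
      using U_isolates[of "{act w x}" "act v x"] act_space[OF \<open>x \<in> V\<close>] by auto
    then show "act v x = act w x"
      using * by auto
  qed auto
  moreover have "Measurable.pred M (\<lambda>x. \<forall>n. act v x \<in> U n \<longrightarrow> act w x \<in> U n)"
    by measurable
  ultimately show ?thesis
    by (simp cong: measurable_cong)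
qed

lemma pred_act_edge [measurable]: "Measurable.pred M (\<lambda>x. (act v x, act w x) \<in> E)"
  using E_sets by measurable

text \<open>A piece consists of the vertices whose ball is enumerated by \<open>ws\<close>, with adjacency matrix
  \<open>es\<close> and list of labels \<open>L\<close>.\<close>

lemma measurable_local_rule:
  fixes lam :: "'a \<Rightarrow> 'a \<Rightarrow> 'l :: countable"
  assumes local: "local_rule t \<R>"
    and lam [measurable]: "\<And>v. (\<lambda>x. lam x (act v x)) \<in> M \<rightarrow>\<^sub>M count_space UNIV"
  shows "(\<lambda>x. \<R> V E (lam x) (act w x)) \<in> M \<rightarrow>\<^sub>M count_space UNIV"
proof -
  define is_piece where "is_piece ws es L x \<longleftrightarrow> ws \<noteq> [] \<and> length L = length ws \<and>
      act (ws ! 0) x = act w x \<and>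
      (\<forall>i<length ws. \<forall>j<length ws. i \<noteq> j \<longrightarrow> \<not> act (ws ! i) x = act (ws ! j) x) \<and>
      (\<forall>v. length v = t \<longrightarrow> (\<exists>i<length ws. act (ws ! i) x = act (w @ v) x)) \<and>
      (\<forall>i<length ws. \<exists>v. length v = t \<and> act (ws ! i) x = act (w @ v) x) \<and>
      (\<forall>i<length ws. \<forall>j<length ws. (act (ws ! i) x, act (ws ! j) x) \<in> E \<longleftrightarrow> (i, j) \<in> set es) \<and>
      (\<forall>i<length ws. lam x (act (ws ! i) x) = L ! i)"
    for ws es L x
  define A where "A = (\<lambda>(ws, es, L). {x \<in> V. is_piece ws es L x})"
  show ?thesis
  proof (rule measurable_piecewise_constant[where A = A])
    fix i :: "nat list list \<times> (nat \<times> nat) list \<times> 'l list"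
    obtain ws es L where i: "i = (ws, es, L)"
      by (cases i)
    have "Measurable.pred M (is_piece ws es L)"
      unfolding is_piece_def by measurable
    then show "A i \<in> sets M"
      by (simp add: A_def i pred_def)
  next
    show "V \<subseteq> (\<Union>i. A i)"
    proof
      fix x assume x: "x \<in> V"
      let ?y = "act w x"
      have y: "?y \<in> V"
        using act_space[OF x] .
      \<comment> \<open>The root is removed and put back at the head of the list, because
        \<open>is_piece\<close> expects it at index 0.\<close>
      have "finite (cball t ?y - {?y})"
        using finite_cball[OF y] by blast
      then obtain ys where ys: "set ys = cball t ?y - {?y}" "distinct ys"
        using finite_distinct_list by blast
      define zs where "zs = ?y # ys"
      have zs: "set zs = cball t ?y" "distinct zs" "zs ! 0 = ?y" "zs \<noteq> []"
        using ys gball_self[OF y] by (auto simp: zs_def)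
      have "\<exists>v. length v = t \<and> z = act v ?y" if "z \<in> set zs" for z
        using that zs(1) cball_iff_act[OF y] by blast
      then obtain v where v: "\<And>z. z \<in> set zs \<Longrightarrow> length (v z) = t \<and> z = act (v z) ?y"
        by metis
      define ws where "ws = map (\<lambda>z. w @ v z) zs"
      have ws: "length ws = length zs" "\<And>i. i < length zs \<Longrightarrow> act (ws ! i) x = zs ! i"
        using v by (auto simp: ws_def)
      obtain es where es: "set es = {(i, j). i < length zs \<and> j < length zs \<and> (zs ! i, zs ! j) \<in> E}"
      proof -
        have "{(i, j). i < length zs \<and> j < length zs \<and> (zs ! i, zs ! j) \<in> E} \<subseteq>
            {..<length zs} \<times> {..<length zs}"
          by auto
        then have "finite {(i, j). i < length zs \<and> j < length zs \<and> (zs ! i, zs ! j) \<in> E}"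
          by (rule finite_subset) simp
        then show thesis
          using finite_list that by blast
      qed
      have "is_piece ws es (map (lam x) zs) x"
        unfolding is_piece_def
      proof (intro conjI allI impI)
        show "\<exists>i<length ws. act (ws ! i) x = act (w @ u) x" if "length u = t" for u
        proof -
          have "act (w @ u) x \<in> set zs"
            using zs(1) cball_iff_act[OF y] that by auto
          then show ?thesis
            using ws by (metis in_set_conv_nth)
        qed
        show "\<exists>u. length u = t \<and> act (ws ! i) x = act (w @ u) x" if "i < length ws" for i
          using that ws v[of "zs ! i"] by (intro exI[of _ "v (zs ! i)"]) auto
      qed (use zs ws es in \<open>auto simp: nth_eq_iff_index_eq\<close>)
      then show "x \<in> (\<Union>i. A i)"
        using x by (auto simp: A_def)
    qed
  next
    fix i :: "nat list list \<times> (nat \<times> nat) list \<times> 'l list" and x x'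
    assume "x \<in> A i" "x' \<in> A i"
    then obtain ws es L where x: "x \<in> V" "is_piece ws es L x" and x': "x' \<in> V" "is_piece ws es L x'"
      by (auto simp: A_def)
    define I where "I = {..<length ws}"
    define h where "h i = act (ws ! i) x" for i
    define h' where "h' i = act (ws ! i) x'" for i
    have bij: "bij_betw (\<lambda>i. act (ws ! i) x) I (cball t (act w x))"
      if xV: "x \<in> V" and piece: "is_piece ws es L x" for x
    proof (rule bij_betw_imageI)
      show "inj_on (\<lambda>i. act (ws ! i) x) I"
        using piece unfolding is_piece_def inj_on_def I_def by blast
      show "(\<lambda>i. act (ws ! i) x) ` I = cball t (act w x)"
      proof (intro set_eqI iffI)
        fix z assume "z \<in> (\<lambda>i. act (ws ! i) x) ` I"
        then obtain i where i: "i < length ws" "z = act (ws ! i) x"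
          by (auto simp: I_def)
        then obtain v where "length v = t" "z = act (w @ v) x"
          using piece unfolding is_piece_def by metis
        then show "z \<in> cball t (act w x)"
          using cball_iff_act[OF act_space[OF xV]] by auto
      next
        fix z assume "z \<in> cball t (act w x)"
        then obtain v where "length v = t" "z = act (w @ v) x"
          using cball_iff_act[OF act_space[OF xV]] by auto
        then obtain i where "i < length ws" "z = act (ws ! i) x"
          using piece unfolding is_piece_def by metis
        then show "z \<in> (\<lambda>i. act (ws ! i) x) ` I"
          by (auto simp: I_def)
      qed
    qed
    have h: "bij_betw h I (cball t (act w x))" and h': "bij_betw h' I (cball t (act w x'))"
      unfolding h_def h'_def using bij x x' by blast+
    define \<phi> where "\<phi> = h' \<circ> inv_into I h"
    have \<phi>: "\<phi> (h i) = h' i" if "i \<in> I" for i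
      using that h by (simp add: \<phi>_def bij_betw_def)
    have ball: "\<exists>i\<in>I. z = h i" if "z \<in> cball t (act w x)" for z
      using that h by (auto simp: bij_betw_def)
    have "rooted_labelled_iso (cball t (act w x)) E (lam x) (act w x)
        (cball t (act w x')) E (lam x') (act w x')"
      unfolding rooted_labelled_iso_def
    proof (intro exI[of _ \<phi>] conjI ballI)
      show "bij_betw \<phi> (cball t (act w x)) (cball t (act w x'))"
        unfolding \<phi>_def using bij_betw_inv_into[OF h] h' by (rule bij_betw_trans)
      have "0 \<in> I" "h 0 = act w x" "h' 0 = act w x'"
        using x(2) x'(2) by (auto simp: is_piece_def I_def h_def h'_def)
      then show "\<phi> (act w x) = act w x'"
        using \<phi>[of 0] by simp
    next
      fix z z' assume "z \<in> cball t (act w x)" "z' \<in> cball t (act w x)"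
      then obtain i j where ij: "i \<in> I" "z = h i" "j \<in> I" "z' = h j"
        using ball by metis
      have "(h i, h j) \<in> E \<longleftrightarrow> (i, j) \<in> set es" "(h' i, h' j) \<in> E \<longleftrightarrow> (i, j) \<in> set es"
        using x(2) x'(2) ij(1,3) by (simp_all add: is_piece_def I_def h_def h'_def)
      then show "(z, z') \<in> E \<longleftrightarrow> (\<phi> z, \<phi> z') \<in> E"
        using ij \<phi> by simp
    next
      fix z assume "z \<in> cball t (act w x)"
      then obtain i where i: "i \<in> I" "z = h i"
        using ball by metis
      have "lam x (h i) = L ! i" "lam x' (h' i) = L ! i"
        using x(2) x'(2) i(1) by (simp_all add: is_piece_def I_def h_def h'_def)
      then show "lam x' (\<phi> z) = lam x z"
        using i \<phi> by simp
    qed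
    then show "\<R> V E (lam x) (act w x) = \<R> V E (lam x') (act w x')"
      using local sg act_space[OF x(1)] act_space[OF x'(1)] unfolding local_rule_def by blast
  qed
qed

end

section \<open>Successive augmentation\<close>

text \<open>The labelling is absorbed into the predicates. In the measurability assumptions the
  assignment \<open>\<alpha> x\<close> may vary with the base point, since they are applied to
  updates performed around \<open>x\<close> itself.\<close>

locale augmenting_process = enumerated_graph M E g U
  for M :: "'a measure" and E g U +
  fixes C P :: "('a \<Rightarrow> nat) \<Rightarrow> 'a \<Rightarrow> bool" and t r \<rho> :: nat and a0 :: "'a \<Rightarrow> nat"
  assumes C_local: "\<And>y a a'. y \<in> V \<Longrightarrow> \<forall>z\<in>cball t y. a z = a' z \<Longrightarrow> C a y = C a' y"
    and P_local: "\<And>y a a'. y \<in> V \<Longrightarrow> \<forall>z\<in>cball t y. a z = a' z \<Longrightarrow> P a y = P a' y"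
    and C_measurable: "\<And>\<alpha> w. (\<And>v. (\<lambda>x. \<alpha> x (act v x)) \<in> M \<rightarrow>\<^sub>M count_space UNIV) \<Longrightarrow>
      Measurable.pred M (\<lambda>x. C (\<alpha> x) (act w x))"
    and P_measurable: "\<And>\<alpha> w. (\<And>v. (\<lambda>x. \<alpha> x (act v x)) \<in> M \<rightarrow>\<^sub>M count_space UNIV) \<Longrightarrow>
      Measurable.pred M (\<lambda>x. P (\<alpha> x) (act w x))"
    and a0_measurable: "a0 \<in> M \<rightarrow>\<^sub>M count_space UNIV"
    and a0_C: "\<And>y. y \<in> V \<Longrightarrow> C a0 y"
begin

text \<open>An update instruction \<open>ps\<close> lists the words leading from a root to the vertices to be
  changed, together with their new values.\<close>

primrec upd :: "('a \<Rightarrow> nat) \<Rightarrow> 'a \<Rightarrow> (nat list \<times> nat) list \<Rightarrow> 'a \<Rightarrow> nat" where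
  "upd a x [] = a"
| "upd a x (p # ps) = (upd a x ps)(act (fst p) x := snd p)"

definition region :: "(nat list \<times> nat) list \<Rightarrow> 'a \<Rightarrow> 'a set" where
  "region ps x = (\<lambda>p. act (fst p) x) ` set ps"

definition bounded_instr :: "(nat list \<times> nat) list \<Rightarrow> bool" where
  "bounded_instr ps \<longleftrightarrow> length ps \<le> r \<and> (\<forall>p\<in>set ps. length (fst p) = \<rho>)"

definition good :: "('a \<Rightarrow> nat) \<Rightarrow> (nat list \<times> nat) list \<Rightarrow> 'a \<Rightarrow> bool" where
  "good a ps x \<longleftrightarrow> bounded_instr ps \<and> (\<forall>y\<in>V. C (upd a x ps) y) \<and>
     (\<forall>y\<in>V. P a y \<longrightarrow> P (upd a x ps) y) \<and> (\<exists>y\<in>V. \<not> P a y \<and> P (upd a x ps) y)"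

text \<open>The radius is twice the reach \<rho> + t of an update, so no vertex is within reach of
  two roots. The point \<open>x\<close> is written \<open>act [] x\<close> to give the equation the
  form treated by \<open>pred_act_eq\<close>.\<close>

definition discrete_set :: "nat \<Rightarrow> 'a set" where
  "discrete_set k = {x \<in> V. x \<in> U k \<and>
     (\<forall>w. length w = (\<rho> + t) + (\<rho> + t) \<longrightarrow> act w x \<in> U k \<longrightarrow> act w x = act [] x)}"

definition roots :: "('a \<Rightarrow> nat) \<Rightarrow> nat \<times> (nat list \<times> nat) list \<Rightarrow> 'a set" where
  "roots a s = {x \<in> discrete_set (fst s). good a (snd s) x}"

text \<open>By the spacing of the roots at most one of them has \<open>y\<close> in its region, so
  the choice is determined.\<close>

definition step :: "('a \<Rightarrow> nat) \<Rightarrow> nat \<times> (nat list \<times> nat) list \<Rightarrow> 'a \<Rightarrow> nat" where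
  "step a s y = (if \<exists>x\<in>roots a s. y \<in> region (snd s) x
     then upd a (SOME x. x \<in> roots a s \<and> y \<in> region (snd s) x) (snd s) y else a y)"

text \<open>Only the first component of the pair coded by \<open>n\<close> is read; the second is
  free and makes every instruction recur.\<close>

definition schedule :: "nat \<Rightarrow> nat \<times> (nat list \<times> nat) list" where
  "schedule n = from_nat (fst (prod_decode n))"

primrec assign :: "nat \<Rightarrow> 'a \<Rightarrow> nat" where
  "assign 0 = a0"
| "assign (Suc n) = step (assign n) (schedule n)"

lemma schedule_recurs: "\<exists>n\<ge>N. schedule n = s"
proof -
  have "schedule (prod_encode (to_nat s, N)) = s"
    by (simp add: schedule_def)
  then show ?thesis
    using le_prod_encode_2 by blast
qed

section \<open>Locality of updates and independence of the roots\<close>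

lemma upd_outside: "y \<notin> region ps x \<Longrightarrow> upd a x ps y = a y"
  by (induction ps) (auto simp: region_def)

lemma upd_map:
  "upd a x (map (\<lambda>y. (w y, b y)) ys) = override_on a b (set ys)"
  if "\<And>y. y \<in> set ys \<Longrightarrow> act (w y) x = y"
  using that by (induction ys) (auto simp: override_on_def fun_eq_iff)

lemma region_cball:
  assumes "bounded_instr ps" "x \<in> V"
  shows "region ps x \<subseteq> cball \<rho> x"
  using assms act_in_cball[OF assms(2)] by (fastforce simp: region_def bounded_instr_def)

lemma region_near:
  assumes "bounded_instr ps" "x \<in> V" "y \<in> V" "z \<in> cball t y" "z \<in> region ps x"
  shows "y \<in> cball (\<rho> + t) x"
proof -
  have "z \<in> cball \<rho> x"
    using region_cball[OF assms(1,2)] assms(5) by blast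
  moreover have "y \<in> cball t z"
    using cball_sym[OF assms(3,4)] .
  ultimately show ?thesis
    by (rule gball_trans)
qed

lemma upd_local:
  assumes "bounded_instr ps" "x \<in> V" "y \<in> V" "y \<notin> cball (\<rho> + t) x"
  shows "C (upd a x ps) y = C a y" "P (upd a x ps) y = P a y"
proof -
  have "\<forall>z\<in>cball t y. upd a x ps z = a z"
    using region_near[OF assms(1-3)] assms(4) upd_outside by blast
  then show "C (upd a x ps) y = C a y" "P (upd a x ps) y = P a y"
    using C_local[OF assms(3)] P_local[OF assms(3)] by blast+
qed

lemma discrete_set_unique:
  assumes "x \<in> discrete_set k" "x' \<in> discrete_set k" "y \<in> cball (\<rho> + t) x" "y \<in> cball (\<rho> + t) x'"
  shows "x = x'"
proof -
  have x: "x \<in> V" "x' \<in> V"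
    using assms by (auto simp: discrete_set_def)
  have "x' \<in> cball ((\<rho> + t) + (\<rho> + t)) x"
    using gball_trans[OF assms(3) cball_sym[OF x(2) assms(4)]] .
  then obtain w where "length w = (\<rho> + t) + (\<rho> + t)" "x' = act w x"
    using cball_iff_act[OF x(1)] by blast
  then show ?thesis
    using assms(1,2) by (auto simp: discrete_set_def)
qed

lemma discrete_set_cover:
  assumes "x \<in> V"
  shows "\<exists>k. x \<in> discrete_set k"
proof -
  obtain k where "x \<in> U k" "U k \<inter> cball ((\<rho> + t) + (\<rho> + t)) x \<subseteq> {x}"
    using U_isolates[OF finite_cball[OF assms] gball_subset assms] by blast
  then have "x \<in> discrete_set k"
    using assms cball_iff_act[OF assms] by (auto simp: discrete_set_def)
  then show ?thesis ..
qed

lemma roots_unique: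
  assumes "x \<in> roots a s" "x' \<in> roots a s" "y \<in> cball (\<rho> + t) x" "y \<in> cball (\<rho> + t) x'"
  shows "x = x'"
  using assms discrete_set_unique by (auto simp: roots_def)

lemma roots_space: "x \<in> roots a s \<Longrightarrow> x \<in> V"
  by (auto simp: roots_def discrete_set_def)

lemma roots_good: "x \<in> roots a s \<Longrightarrow> good a (snd s) x"
  by (auto simp: roots_def)

lemma roots_bounded: "x \<in> roots a s \<Longrightarrow> bounded_instr (snd s)"
  by (auto simp: roots_def good_def)

text \<open>A root whose region meets the ball of radius \<open>t\<close> around \<open>y\<close>
  has \<open>y\<close> within \<rho> + t, and only \<open>x\<close> does. To a rule evaluated at
  \<open>y\<close>, the simultaneous updates look like the single update at \<open>x\<close>, so
  goodness at \<open>x\<close> carries over.\<close>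

lemma step_eq_upd:
  assumes "x \<in> roots a s" "y \<in> cball (\<rho> + t) x" "z \<in> cball t y"
  shows "step a s z = upd a x (snd s) z"
proof -
  have unique: "x' = x" if "x' \<in> roots a s" "z \<in> region (snd s) x'" for x'
  proof -
    have "y \<in> V"
      using gball_space[OF assms(2)] .
    then have "y \<in> cball (\<rho> + t) x'"
      by (rule region_near[OF roots_bounded[OF that(1)] roots_space[OF that(1)] _ assms(3) that(2)])
    then show ?thesis
      using roots_unique that(1) assms(1,2) by blast
  qed
  show ?thesis
  proof (cases "z \<in> region (snd s) x")
    case True
    have "(SOME x. x \<in> roots a s \<and> z \<in> region (snd s) x) = x"
      using True assms(1) unique by (intro some_equality) blast+
    then show ?thesis
      using True assms(1) by (auto simp: step_def)
  next
    case False
    then have "\<not> (\<exists>x\<in>roots a s. z \<in> region (snd s) x)"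
      using unique by blast
    then show ?thesis
      using False upd_outside by (simp add: step_def)
  qed
qed

lemma step_near:
  assumes "x \<in> roots a s" "y \<in> cball (\<rho> + t) x"
  shows "C (step a s) y = C (upd a x (snd s)) y" "P (step a s) y = P (upd a x (snd s)) y"
proof -
  have "y \<in> V"
    using gball_space[OF assms(2)] .
  moreover have "\<forall>z\<in>cball t y. step a s z = upd a x (snd s) z"
    using step_eq_upd[OF assms] by blast
  ultimately show "C (step a s) y = C (upd a x (snd s)) y" "P (step a s) y = P (upd a x (snd s)) y"
    by (rule C_local P_local)+
qed

lemma step_far:
  assumes "y \<in> V" "\<And>x. x \<in> roots a s \<Longrightarrow> y \<notin> cball (\<rho> + t) x"
  shows "C (step a s) y = C a y" "P (step a s) y = P a y"
proof -
  have "\<not> (\<exists>x\<in>roots a s. z \<in> region (snd s) x)" if "z \<in> cball t y" for z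
    using region_near[OF roots_bounded roots_space assms(1) that] assms(2) by blast
  then have "\<forall>z\<in>cball t y. step a s z = a z"
    by (simp add: step_def)
  then show "C (step a s) y = C a y" "P (step a s) y = P a y"
    using C_local[OF assms(1)] P_local[OF assms(1)] by blast+
qed

lemma step_C:
  assumes "\<forall>y\<in>V. C a y" "y \<in> V"
  shows "C (step a s) y"
proof (cases "\<exists>x\<in>roots a s. y \<in> cball (\<rho> + t) x")
  case True
  then obtain x where x: "x \<in> roots a s" "y \<in> cball (\<rho> + t) x"
    by blast
  show ?thesis
    using step_near(1)[OF x] roots_good[OF x(1)] assms(2) by (simp add: good_def)
next
  case False
  then show ?thesis
    using step_far[OF assms(2)] assms by blast
qed

lemma step_P:
  assumes "y \<in> V" "P a y"
  shows "P (step a s) y"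
proof (cases "\<exists>x\<in>roots a s. y \<in> cball (\<rho> + t) x")
  case True
  then obtain x where x: "x \<in> roots a s" "y \<in> cball (\<rho> + t) x"
    by blast
  show ?thesis
    using step_near(2)[OF x] roots_good[OF x(1)] assms by (simp add: good_def)
next
  case False
  then show ?thesis
    using step_far[OF assms(1)] assms by blast
qed

lemma step_gain:
  assumes "x \<in> roots a s"
  shows "\<exists>y\<in>cball (\<rho> + t) x. \<not> P a y \<and> P (step a s) y"
proof -
  obtain y where y: "y \<in> V" "\<not> P a y" "P (upd a x (snd s)) y"
    using roots_good[OF assms] by (auto simp: good_def)
  then have "y \<in> cball (\<rho> + t) x"
    using upd_local(2)[OF roots_bounded[OF assms] roots_space[OF assms]] by blast
  then show ?thesis
    using y step_near(2)[OF assms] by blast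
qed

lemma step_change: "step a s y \<noteq> a y \<Longrightarrow> \<exists>x\<in>roots a s. y \<in> region (snd s) x"
  by (auto simp: step_def split: if_splits)

text \<open>Two words are needed: with \<open>w\<close> empty the update is seen from its root
  (\<open>roots_sets\<close>), with \<open>v\<close> empty from a vertex it changes
  (\<open>step_measurable\<close>).\<close>

lemma upd_measurable:
  assumes a [measurable]: "a \<in> M \<rightarrow>\<^sub>M count_space UNIV"
  shows "(\<lambda>x. upd a (act w x) ps (act v x)) \<in> M \<rightarrow>\<^sub>M count_space UNIV"
proof (induction ps)
  case Nil
  have "(\<lambda>x. a (act v x)) \<in> M \<rightarrow>\<^sub>M count_space UNIV"
    by measurable
  then show ?case
    by simp
next
  case (Cons p ps)
  note [measurable] = Cons
  have "(\<lambda>x. if act v x = act (w @ fst p) x then snd p else upd a (act w x) ps (act v x))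
      \<in> M \<rightarrow>\<^sub>M count_space UNIV"
    by measurable
  then show ?case
    by (simp add: fun_upd_def)
qed

text \<open>A vertex that no word reaches from \<open>x\<close> lies beyond \<rho> + t, where the
  update alters neither predicate: \<open>C\<close> holds there by assumption, and progress is
  neither lost nor gained.\<close>

lemma good_iff_act:
  assumes "\<forall>y\<in>V. C a y" "x \<in> V"
  shows "good a ps x \<longleftrightarrow> bounded_instr ps \<and> (\<forall>w. C (upd a x ps) (act w x)) \<and>
     (\<forall>w. P a (act w x) \<longrightarrow> P (upd a x ps) (act w x)) \<and>
     (\<exists>w. \<not> P a (act w x) \<and> P (upd a x ps) (act w x))"
proof (cases "bounded_instr ps")
  case True
  have *: "\<exists>w. y = act w x" if "y \<in> V" "C (upd a x ps) y \<noteq> C a y \<or> P (upd a x ps) y \<noteq> P a y" for y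
    using upd_local[OF True assms(2) that(1)] that(2) cball_iff_act[OF assms(2)] by blast
  have "(\<forall>y\<in>V. C (upd a x ps) y) \<longleftrightarrow> (\<forall>w. C (upd a x ps) (act w x))"
    using * assms act_space[OF assms(2)] by metis
  moreover have "(\<forall>y\<in>V. P a y \<longrightarrow> P (upd a x ps) y) \<longleftrightarrow> (\<forall>w. P a (act w x) \<longrightarrow> P (upd a x ps) (act w x))"
    using * act_space[OF assms(2)] by metis
  moreover have "(\<exists>y\<in>V. \<not> P a y \<and> P (upd a x ps) y) \<longleftrightarrow>
      (\<exists>w. \<not> P a (act w x) \<and> P (upd a x ps) (act w x))"
    using * act_space[OF assms(2)] by metis
  ultimately show ?thesis
    by (simp add: good_def)
qed (simp add: good_def)

lemma roots_sets:
  assumes a [measurable]: "a \<in> M \<rightarrow>\<^sub>M count_space UNIV" and C: "\<forall>y\<in>V. C a y"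
  shows "roots a s \<in> sets M"
proof -
  have a': "(\<lambda>x. a (act v x)) \<in> M \<rightarrow>\<^sub>M count_space UNIV" for v
    by measurable
  have upd': "(\<lambda>x. upd a x ps (act v x)) \<in> M \<rightarrow>\<^sub>M count_space UNIV" for ps v
    using upd_measurable[OF a, of "[]"] by simp
  note [measurable] = C_measurable[of "\<lambda>x. upd a x (snd s)", OF upd']
    P_measurable[of "\<lambda>x. upd a x (snd s)", OF upd'] P_measurable[of "\<lambda>x. a", OF a']
  have "roots a s = {x \<in> V. (x \<in> U (fst s) \<and>
     (\<forall>w. length w = (\<rho> + t) + (\<rho> + t) \<longrightarrow> act w x \<in> U (fst s) \<longrightarrow> act w x = act [] x)) \<and>
     bounded_instr (snd s) \<and> (\<forall>w. C (upd a x (snd s)) (act w x)) \<and>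
     (\<forall>w. P a (act w x) \<longrightarrow> P (upd a x (snd s)) (act w x)) \<and>
     (\<exists>w. \<not> P a (act w x) \<and> P (upd a x (snd s)) (act w x))}"
    using good_iff_act[OF C] by (auto simp: roots_def discrete_set_def)
  also have "\<dots> \<in> sets M"
    by measurable
  finally show ?thesis .
qed

lemma step_measurable:
  assumes a [measurable]: "a \<in> M \<rightarrow>\<^sub>M count_space UNIV" and C: "\<forall>y\<in>V. C a y"
  shows "step a s \<in> M \<rightarrow>\<^sub>M count_space UNIV"
proof (rule measurable_nat_via_pred)
  fix n
  note [measurable] = roots_sets[OF assms, of s] upd_measurable[OF a]
  \<comment> \<open>\<open>w\<close> leads from \<open>y\<close> back to the root that changes it.
    Several words may do so, but all of them give the same value, which replaces the choice in
    \<open>step\<close> by a countable disjunction.\<close>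
  define chosen where "chosen w y \<longleftrightarrow> length w = \<rho> \<and> act w y \<in> roots a s \<and>
      (\<exists>p\<in>set (snd s). act (w @ fst p) y = act [] y)" for w y
  have [measurable]: "Measurable.pred M (chosen w)" for w
    unfolding chosen_def by measurable
  have ex: "\<exists>w. x = act w y \<and> chosen w y" if y: "y \<in> V" "x \<in> roots a s" "y \<in> region (snd s) x" for x y
  proof -
    have "x \<in> cball \<rho> y"
      using cball_sym[OF roots_space[OF y(2)]] region_cball[OF roots_bounded[OF y(2)] roots_space[OF y(2)]]
        y(3) by blast
    then obtain w where "length w = \<rho>" "x = act w y"
      using cball_iff_act[OF y(1)] by blast
    then show ?thesis
      using y by (force simp: chosen_def region_def)
  qed
  have chosenD: "act w y \<in> roots a s" "y \<in> region (snd s) (act w y)" if "chosen w y" for w y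
    using that by (force simp: chosen_def region_def)+
  have step_chosen: "step a s y = upd a (act w y) (snd s) (act [] y)" if "y \<in> V" "chosen w y" for w y
  proof -
    have "y \<in> cball \<rho> (act w y)"
      using chosenD[OF that(2)] region_cball roots_bounded roots_space by blast
    then have "y \<in> cball (\<rho> + t) (act w y)"
      using gball_mono[of \<rho> "\<rho> + t" V E "act w y"] by auto
    then show ?thesis
      using step_eq_upd[OF chosenD(1)[OF that(2)] _ gball_self[OF that(1)]] by simp
  qed
  have "step a s y = n \<longleftrightarrow> (\<exists>w. chosen w y \<and> upd a (act w y) (snd s) (act [] y) = n) \<or>
      (\<forall>w. \<not> chosen w y) \<and> a y = n" if y: "y \<in> V" for y
  proof (cases "\<exists>w. chosen w y")
    case True
    then show ?thesis
      using step_chosen[OF y] by auto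
  next
    case False
    then have "\<not> (\<exists>x\<in>roots a s. y \<in> region (snd s) x)"
      using ex[OF y] by blast
    then show ?thesis
      using False by (simp add: step_def)
  qed
  moreover have "Measurable.pred M (\<lambda>y. (\<exists>w. chosen w y \<and> upd a (act w y) (snd s) (act [] y) = n) \<or>
      (\<forall>w. \<not> chosen w y) \<and> a y = n)"
    by measurable
  ultimately show "Measurable.pred M (\<lambda>y. step a s y = n)"
    by (simp cong: measurable_cong)
qed

section \<open>The sequence of assignments and its limit\<close>

lemma assign_C: "y \<in> V \<Longrightarrow> C (assign n) y"
  by (induction n arbitrary: y) (auto intro: a0_C step_C)

lemma assign_measurable [measurable]: "assign n \<in> M \<rightarrow>\<^sub>M count_space UNIV"
  by (induction n) (auto intro: a0_measurable step_measurable assign_C)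

lemma assign_P_mono: "n \<le> m \<Longrightarrow> y \<in> V \<Longrightarrow> P (assign n) y \<Longrightarrow> P (assign m) y"
  by (induction m rule: dec_induct) (auto intro: step_P)

text \<open>Every change of the value at \<open>y\<close> is paid for by a vertex near \<open>y\<close> that enters the progress
  set, and a vertex enters only once.\<close>

lemma finite_changes:
  assumes "y \<in> V"
  shows "finite {n. assign (Suc n) y \<noteq> assign n y}"
proof -
  \<comment> \<open>The radius leads from \<open>y\<close> back to the root, at most \<rho>, and on
    to the vertex gained by that root, at most \<rho> + t.\<close>
  have "\<exists>z. z \<in> cball (\<rho> + (\<rho> + t)) y \<and> \<not> P (assign n) z \<and> P (assign (Suc n)) z"
    if n: "assign (Suc n) y \<noteq> assign n y" for n
  proof -
    obtain x where x: "x \<in> roots (assign n) (schedule n)" "y \<in> region (snd (schedule n)) x"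
      using step_change n by (metis assign.simps(2))
    then have "y \<in> cball \<rho> x"
      using region_cball roots_bounded roots_space by blast
    then have "x \<in> cball \<rho> y"
      using cball_sym roots_space[OF x(1)] by blast
    then show ?thesis
      using step_gain[OF x(1)] gball_trans by (metis assign.simps(2))
  qed
  then obtain z where z: "\<And>n. assign (Suc n) y \<noteq> assign n y \<Longrightarrow>
      z n \<in> cball (\<rho> + (\<rho> + t)) y \<and> \<not> P (assign n) (z n) \<and> P (assign (Suc n)) (z n)"
    by metis
  have "inj_on z {n. assign (Suc n) y \<noteq> assign n y}"
  proof (rule linorder_inj_onI)
    fix n m assume "n < m" "n \<in> {n. assign (Suc n) y \<noteq> assign n y}" "m \<in> {n. assign (Suc n) y \<noteq> assign n y}"
    then show "z n \<noteq> z m"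
      using z[of n] z[of m] assign_P_mono[of "Suc n" m "z n"] gball_space[of "z n" V E] by fastforce
  qed auto
  moreover have "finite (z ` {n. assign (Suc n) y \<noteq> assign n y})"
    using z finite_cball[OF assms] by (auto intro: finite_subset)
  ultimately show ?thesis
    using finite_image_iff by blast
qed

lemma assign_stabilises:
  assumes "y \<in> V"
  shows "\<exists>N. \<forall>n\<ge>N. assign n y = assign N y"
proof -
  obtain N where "\<forall>n\<in>{n. assign (Suc n) y \<noteq> assign n y}. n < N"
    using finite_changes[OF assms] finite_nat_set_iff_bounded by blast
  then have N: "assign (Suc n) y = assign n y" if "n \<ge> N" for n
    using that by (metis (mono_tags, lifting) mem_Collect_eq not_le)
  have "assign n y = assign N y" if "n \<ge> N" for n
    using that N by (induction n rule: dec_induct) auto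
  then show ?thesis
    by blast
qed

definition limit :: "'a \<Rightarrow> nat" where
  "limit y = assign (SOME N. \<forall>n\<ge>N. assign n y = assign N y) y"

lemma limit_eventually:
  assumes "y \<in> V"
  shows "\<exists>N. \<forall>n\<ge>N. assign n y = limit y"
  using someI_ex[OF assign_stabilises[OF assms]] unfolding limit_def by blast

lemma limit_eventually_finite:
  assumes "finite F" "F \<subseteq> V"
  shows "\<exists>N. \<forall>n\<ge>N. \<forall>y\<in>F. assign n y = limit y"
  using assms
proof (induction F rule: finite_induct)
  case (insert y F)
  then obtain N N' where "\<forall>n\<ge>N. \<forall>y\<in>F. assign n y = limit y" "\<forall>n\<ge>N'. assign n y = limit y"
    using limit_eventually[of y] by auto
  then show ?case
    by (intro exI[of _ "max N N'"]) auto
qed simp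

lemma limit_measurable: "limit \<in> M \<rightarrow>\<^sub>M count_space UNIV"
proof (rule measurable_nat_via_pred)
  fix k
  have "limit y = k \<longleftrightarrow> (\<exists>N. \<forall>n\<ge>N. assign n y = k)" if "y \<in> V" for y
    using limit_eventually[OF that] by (metis nle_le)
  moreover have "Measurable.pred M (\<lambda>y. \<exists>N. \<forall>n\<ge>N. assign n y = k)"
    by measurable
  ultimately show "Measurable.pred M (\<lambda>y. limit y = k)"
    by (simp cong: measurable_cong)
qed

lemma limit_local:
  assumes "y \<in> V"
  shows "\<exists>N. \<forall>n\<ge>N. C (assign n) y = C limit y \<and> P (assign n) y = P limit y"
proof -
  obtain N where "\<forall>n\<ge>N. \<forall>z\<in>cball t y. assign n z = limit z"
    using limit_eventually_finite[OF finite_cball[OF assms] gball_subset] by blast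
  then show ?thesis
    using C_local[OF assms] P_local[OF assms] by blast
qed

lemma limit_C: "y \<in> V \<Longrightarrow> C limit y"
  using limit_local assign_C by blast

lemma limit_P:
  assumes "y \<in> V"
  shows "P limit y \<longleftrightarrow> (\<exists>n. P (assign n) y)"
  using limit_local[OF assms] assign_P_mono[OF _ assms] by (metis nle_le)

text \<open>A late \<open>assign n\<close> agrees with the limit only on a finite ball. Beyond
  \<rho> + t the instruction leaves both predicates as they are under \<open>assign n\<close>, so
  goodness needs no comparison with the limit there. When the instruction is carried out, a vertex
  near \<open>x\<close> enters the progress set at a stage where that set already agrees nearby with
  the one of the limit.\<close>

lemma limit_not_augmentable:
  assumes R: "R \<subseteq> cball \<rho> x" "x \<in> V" "finite R" "card R \<le> r"
    and C: "\<forall>y\<in>V. C (override_on limit b R) y"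
    and P: "\<forall>y\<in>V. P limit y \<longrightarrow> P (override_on limit b R) y"
    and gain: "\<exists>y\<in>V. \<not> P limit y \<and> P (override_on limit b R) y"
  shows False
proof -
  obtain ys where ys: "set ys = R" "distinct ys"
    using finite_distinct_list[OF R(3)] by blast
  have "\<exists>w. length w = \<rho> \<and> act w x = y" if "y \<in> R" for y
    using R(1) that by (intro cball_imp_act) blast
  then obtain w where w: "\<And>y. y \<in> R \<Longrightarrow> length (w y) = \<rho> \<and> act (w y) x = y"
    by metis
  define ps where "ps = map (\<lambda>y. (w y, b y)) ys"
  have bounded: "bounded_instr ps"
    using w ys R(4) distinct_card[OF ys(2)] by (auto simp: bounded_instr_def ps_def)
  have upd_eq: "upd a x ps = override_on a b R" for a
    unfolding ps_def using upd_map[of ys w x a b] w ys by simp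
  obtain k where k: "x \<in> discrete_set k"
    using discrete_set_cover[OF R(2)] by blast
  \<comment> \<open>The predicates are compared at vertices up to \<rho> + t from \<open>x\<close>
    and see a further \<open>t\<close>.\<close>
  obtain N where N: "\<And>n z. n \<ge> N \<Longrightarrow> z \<in> cball ((\<rho> + t) + t) x \<Longrightarrow> assign n z = limit z"
    using limit_eventually_finite[OF finite_cball[OF R(2)] gball_subset] by metis
  obtain n where n: "n \<ge> N" "schedule n = (k, ps)"
    using schedule_recurs by blast
  have ball: "assign n z = limit z" if "y \<in> cball (\<rho> + t) x" "z \<in> cball t y" for y z
    using N[OF n(1)] gball_trans[OF that] by blast
  have near: "C (upd (assign n) x ps) y = C (override_on limit b R) y"
    "P (upd (assign n) x ps) y = P (override_on limit b R) y" "P (assign n) y = P limit y"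
    if "y \<in> cball (\<rho> + t) x" for y
  proof -
    have "y \<in> V"
      using gball_space[OF that] .
    moreover have "\<forall>z\<in>cball t y. upd (assign n) x ps z = override_on limit b R z"
      "\<forall>z\<in>cball t y. assign n z = limit z"
      using ball[OF that] by (auto simp: upd_eq override_on_def)
    ultimately show "C (upd (assign n) x ps) y = C (override_on limit b R) y"
      "P (upd (assign n) x ps) y = P (override_on limit b R) y" "P (assign n) y = P limit y"
      using C_local P_local by blast+
  qed
  have far: "C (upd a x ps) y = C a y" "P (upd a x ps) y = P a y"
    if "y \<in> V" "y \<notin> cball (\<rho> + t) x" for a y
    using upd_local[OF bounded R(2) that] .
  have "good (assign n) ps x"
    unfolding good_def
  proof (intro conjI ballI impI bounded)
    fix y assume y: "y \<in> V"
    show "C (upd (assign n) x ps) y"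
      using near(1)[of y] far(1)[OF y] C y assign_C by blast
    show "P (upd (assign n) x ps) y" if "P (assign n) y"
      using near(2,3)[of y] far(2)[OF y] P y that by blast
  next
    obtain y where y: "y \<in> V" "\<not> P limit y" "P (override_on limit b R) y"
      using gain by blast
    have "y \<in> cball (\<rho> + t) x"
      using far(2)[OF y(1), of limit] y upd_eq by metis
    then show "\<exists>y\<in>V. \<not> P (assign n) y \<and> P (upd (assign n) x ps) y"
      using near y by blast
  qed
  then have "x \<in> roots (assign n) (schedule n)"
    using k n(2) by (simp add: roots_def)
  then obtain y where y: "y \<in> cball (\<rho> + t) x" "\<not> P (assign n) y" "P (assign (Suc n)) y"
    using step_gain by (metis assign.simps(2))
  then have "P limit y"
    using limit_P[OF gball_space[OF y(1)]] by blast
  then show False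
    using near(3)[OF y(1)] y(2) by blast
qed

text \<open>One number codes both the stage at which \<open>v\<close> enters and a word from
  \<open>v\<close> to the root responsible, so that \<open>LEAST\<close> picks the two together in a
  measurable way.\<close>

definition entry :: "nat \<Rightarrow> 'a \<Rightarrow> bool" where
  "entry c v \<longleftrightarrow> (case from_nat c of (n, w) \<Rightarrow>
     \<not> P (assign n) v \<and> P (assign (Suc n)) v \<and> length w = \<rho> + t \<and>
     act w v \<in> roots (assign n) (schedule n))"

text \<open>Every \<open>target j c\<close> acts by a word, even if the instruction is too short or
  \<open>c\<close> is no entry; so \<open>witness\<close> always stays in the component.\<close>

definition target :: "nat \<Rightarrow> nat \<Rightarrow> 'a \<Rightarrow> 'a" where
  "target j c = (case from_nat c of (n, w) \<Rightarrow>
     if j < length (snd (schedule n)) then act (w @ fst (snd (schedule n) ! j)) else act [])"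

definition witness :: "nat \<Rightarrow> 'a \<Rightarrow> 'a" where
  "witness j v = target j (LEAST c. entry c v) v"

lemma witness_connected: "v \<in> V \<Longrightarrow> (v, witness j v) \<in> connectivity_rel V E"
  unfolding witness_def target_def
  by (auto simp del: act_append act_simps intro: act_connected split: prod.split)

lemma witness_measurable: "witness j \<in> M \<rightarrow>\<^sub>M M"
proof -
  have [measurable]: "Measurable.pred M (P (assign n))" for n
    using P_measurable[of "\<lambda>_. assign n" "[]"] by simp
  have [measurable]: "roots (assign n) s \<in> sets M" for n s
    using roots_sets assign_C by simp
  have "Measurable.pred M (entry c)" for c
    unfolding entry_def by (cases "from_nat c :: nat \<times> nat list") (simp del: assign.simps)
  then have least: "(\<lambda>v. LEAST c. entry c v) \<in> M \<rightarrow>\<^sub>M count_space UNIV"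
    by (rule measurable_Least)
  have "target j c \<in> M \<rightarrow>\<^sub>M M" for c
    unfolding target_def by (auto split: prod.split)
  from measurable_compose_countable[OF this least] show ?thesis
    unfolding witness_def .
qed

text \<open>Around the root of any stage that changes \<open>x\<close>, some \<open>v\<close> enters
  the progress set. The least entry of \<open>v\<close> may use another word, but it yields the same
  stage and the same root, hence the same list of at most \<open>r\<close> changed vertices, and
  \<open>x\<close> has a place \<open>j\<close> in it.\<close>

lemma changed_witnessed:
  assumes "x \<in> V" "limit x \<noteq> a0 x"
  shows "\<exists>j<r. \<exists>v\<in>V. P limit v \<and> \<not> P a0 v \<and> witness j v = x"
proof -
  obtain n where n: "assign (Suc n) x \<noteq> assign n x"
  proof (rule ccontr)
    assume "\<not> thesis"
    then have "assign (Suc n) x = assign n x" for n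
      using that by blast
    then have "assign n x = a0 x" for n
      by (induction n) (simp_all del: assign.simps(2))
    then show False
      using limit_eventually[OF assms(1)] assms(2) by auto
  qed
  let ?ps = "snd (schedule n)"
  obtain y where y: "y \<in> roots (assign n) (schedule n)" "x \<in> region ?ps y"
    using step_change n by (metis assign.simps(2))
  obtain v where v: "v \<in> cball (\<rho> + t) y" "\<not> P (assign n) v" "P (assign (Suc n)) v"
    using step_gain[OF y(1)] by auto
  have vV: "v \<in> V"
    using gball_space[OF v(1)] .
  obtain w where w: "length w = \<rho> + t" "act w v = y"
    using cball_imp_act[OF cball_sym[OF roots_space[OF y(1)] v(1)]] by blast
  have "entry (to_nat (n, w)) v"
    using v w y by (simp add: entry_def)
  then have "entry (LEAST c. entry c v) v"
    by (rule LeastI)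
  moreover obtain m u where mu: "from_nat (LEAST c. entry c v) = (m :: nat, u :: nat list)"
    by fastforce
  ultimately have m: "\<not> P (assign m) v" "P (assign (Suc m)) v" "length u = \<rho> + t"
    "act u v \<in> roots (assign m) (schedule m)"
    by (auto simp: entry_def)
  \<comment> \<open>The progress sets increase, so a vertex outside at one stage and inside at the
    next does this only once.\<close>
  have "m = n"
  proof (rule ccontr)
    assume "m \<noteq> n"
    then have "Suc m \<le> n \<or> Suc n \<le> m"
      by auto
    then show False
      using assign_P_mono[OF _ vV] v m by blast
  qed
  have "v \<in> cball (\<rho> + t) (act u v)"
    using cball_sym[OF vV act_in_cball[OF vV, of u]] m(3) by simp
  then have "act u v = y"
    using roots_unique[OF _ y(1) _ v(1)] m(4) \<open>m = n\<close> by blast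
  obtain j where j: "j < length ?ps" "x = act (fst (?ps ! j)) y"
    using y(2) by (auto simp: region_def in_set_conv_nth)
  have "witness j v = x"
    using mu \<open>m = n\<close> \<open>act u v = y\<close> j by (simp add: witness_def target_def)
  moreover have "j < r"
    using j(1) roots_bounded[OF y(1)] by (simp add: bounded_instr_def)
  moreover have "P limit v"
    using limit_P[OF vV] v(3) by blast
  moreover have "\<not> P a0 v"
    using assign_P_mono[of 0 n v] v(2) vV by auto
  ultimately show ?thesis
    using vV by blast
qed

end

section \<open>Application to locally checkable labellings\<close>

lemma (in enumerated_graph) measurable_lcl:
  assumes "local_rule t \<R>" and l [measurable]: "l \<in> M \<rightarrow>\<^sub>M count_space UNIV"
    and [measurable]: "\<And>v. (\<lambda>x. \<alpha> x (act v x)) \<in> M \<rightarrow>\<^sub>M count_space UNIV"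
  shows "Measurable.pred M (\<lambda>x. \<R> V E (\<lambda>z. (l z :: nat, \<alpha> x z :: nat)) (act w x) = (1 :: nat))"
proof -
  have "(\<lambda>x. (l (act v x), \<alpha> x (act v x))) \<in> M \<rightarrow>\<^sub>M count_space UNIV" for v
    by measurable
  from measurable_local_rule[OF assms(1), of "\<lambda>x z. (l z, \<alpha> x z)", OF this, measurable]
  show ?thesis
    by measurable
qed

theorem theorem5p25:
  fixes M :: "'a measure" and E :: "('a \<times> 'a) set"
    and \<C> \<P> :: "('a, nat \<times> nat, nat) rule"
    and l a0 :: "'a \<Rightarrow> nat" and r :: nat
  assumes "LCL \<C>" and "LCL \<P>"
    and "borel_graph M E" and "locally_finite (space M) E"
    and "l \<in> M \<rightarrow>\<^sub>M count_space UNIV"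
    and "a0 \<in> M \<rightarrow>\<^sub>M count_space UNIV"
    and "solves \<C> (space M) E l a0"
    and "r \<ge> 1"
  shows "\<exists>a. a \<in> M \<rightarrow>\<^sub>M count_space UNIV \<and>
    solves \<C> (space M) E l a \<and>
    \<not> (\<exists>a'. augmentation \<C> \<P> (space M) E l r a a') \<and>
    (\<exists>f :: nat \<Rightarrow> 'a \<Rightarrow> 'a.
      (\<forall>j<r.
        f j \<in> restrict_space M (lcl_set \<P> (space M) E l a - lcl_set \<P> (space M) E l a0) \<rightarrow>\<^sub>M M \<and>
        (\<forall>x \<in> lcl_set \<P> (space M) E l a - lcl_set \<P> (space M) E l a0.
          (x, f j x) \<in> connectivity_rel (space M) E)) \<and>
      (\<forall>x \<in> space M. a x \<noteq> a0 x \<longrightarrow>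
        (\<exists>j<r. x \<in> f j ` (lcl_set \<P> (space M) E l a - lcl_set \<P> (space M) E l a0))))"
proof -
  have sg: "sgraph (space M) E" and E: "E \<in> sets (M \<Otimes>\<^sub>M M)" and "standard_borel M"
    using assms(3) by (auto simp: borel_graph_def)
  then obtain X U where "polish_base M X U"
    using standard_borel_imp_polish_base by blast
  then interpret polish_base M X U .
  have "finite (E `` {x})" if "x \<in> space M" for x
    using assms(4) that by (simp add: locally_finite_def)
  then obtain h :: "nat \<Rightarrow> 'a \<Rightarrow> 'a" where h: "\<And>n. h n \<in> M \<rightarrow>\<^sub>M M"
    "\<And>n x. x \<in> space M \<Longrightarrow> h n x = x \<or> (x, h n x) \<in> E"
    "\<And>x y. (x, y) \<in> E \<Longrightarrow> \<exists>n. h n x = y"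
    using Lusin_Novikov_finite_sections[OF E] by metis
  \<comment> \<open>The shift makes room for the identity at index 0, which pads words.\<close>
  define g where "g n = (case n of 0 \<Rightarrow> \<lambda>x. x | Suc n \<Rightarrow> h n)" for n
  interpret enumerated_graph M E g U
  proof
    show "\<exists>n. g n x = y" if "(x, y) \<in> E" for x y
    proof -
      obtain n where "h n x = y"
        using h(3)[OF \<open>(x, y) \<in> E\<close>] by blast
      then show ?thesis
        by (intro exI[of _ "Suc n"]) (simp add: g_def)
    qed
  qed (use sg E assms(4) h U_isolates in \<open>auto simp: g_def split: nat.split\<close>)
  obtain tC tP where tC: "local_rule tC \<C>" and tP: "local_rule tP \<P>"
    using assms(1,2) by (auto simp: LCL_def)
  define C where "C a y \<longleftrightarrow> \<C> V E (\<lambda>z. (l z, a z)) y = 1" for a y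
  define P where "P a y \<longleftrightarrow> \<P> V E (\<lambda>z. (l z, a z)) y = 1" for a y
  have C_eq: "solves \<C> V E l a \<longleftrightarrow> (\<forall>y\<in>V. C a y)" for a
    by (auto simp: solves_def lcl_set_def C_def)
  have P_eq: "lcl_set \<P> V E l a = {y \<in> V. P a y}" for a
    by (simp add: lcl_set_def P_def)
  \<comment> \<open>The sum is a common radius for both rules, and \<open>r * r\<close> is the
    radius found in \<open>induced_connected_subset_gball\<close>.\<close>
  interpret augmenting_process M E g U C P "tC + tP" r "r * r" a0
  proof
    fix y and a a' :: "'a \<Rightarrow> nat" assume y: "y \<in> V" "\<forall>z\<in>cball (tC + tP) y. a z = a' z"
    show "C a y = C a' y"
      unfolding C_def using y gball_mono[of tC "tC + tP" V E y]
      by (subst local_rule_cong[OF tC sg, of _ _ "\<lambda>z. (l z, a' z)"]) auto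
    show "P a y = P a' y"
      unfolding P_def using y gball_mono[of tP "tC + tP" V E y]
      by (subst local_rule_cong[OF tP sg, of _ _ "\<lambda>z. (l z, a' z)"]) auto
  next
    show "C a0 y" if "y \<in> V" for y
      using assms(7) C_eq that by blast
  qed (use measurable_lcl[OF tC assms(5)] measurable_lcl[OF tP assms(5)] assms(6) in
      \<open>simp_all add: C_def P_def\<close>)
  have no_aug: "\<not> augmentation \<C> \<P> V E l r limit a'" for a'
  proof
    assume "augmentation \<C> \<P> V E l r limit a'"
    then obtain R b where R: "R \<subseteq> V" "induced_connected E R" "finite R" "card R \<le> r"
      and C: "\<forall>y\<in>V. C (override_on limit b R) y"
      and P: "{y \<in> V. P limit y} \<subset> {y \<in> V. P (override_on limit b R) y}"
      unfolding augmentation_def C_eq P_eq by blast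
    \<comment> \<open>Changing nothing gains nothing; so \<open>R\<close> has a vertex, and any of
      them can be the root.\<close>
    have "R \<noteq> {}"
      using P by auto
    then obtain x where x: "x \<in> R"
      by blast
    then have "R \<subseteq> cball (r * r) x" "x \<in> V"
      using induced_connected_subset_gball[OF R(2,1,3,4)] R(1) by blast+
    then show False
      by (rule limit_not_augmentable[OF _ _ R(3,4) C]) (use P in blast)+
  qed
  have P_space: "lcl_set \<P> V E l limit - lcl_set \<P> V E l a0 \<subseteq> V"
    unfolding P_eq by blast
  show ?thesis
  proof (intro exI[of _ limit] exI[of _ witness] conjI allI impI ballI)
    show "limit \<in> M \<rightarrow>\<^sub>M count_space UNIV"
      by (rule limit_measurable)
    show "solves \<C> V E l limit"
      using C_eq limit_C by blast
    show "\<not> (\<exists>a'. augmentation \<C> \<P> V E l r limit a')"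
      using no_aug by blast
    show "witness j \<in> restrict_space M (lcl_set \<P> V E l limit - lcl_set \<P> V E l a0) \<rightarrow>\<^sub>M M" for j
      using witness_measurable by (rule measurable_restrict_space1)
    show "(x, witness j x) \<in> connectivity_rel V E"
      if "x \<in> lcl_set \<P> V E l limit - lcl_set \<P> V E l a0" for j x
      using that P_space by (intro witness_connected) blast
    show "\<exists>j<r. x \<in> witness j ` (lcl_set \<P> V E l limit - lcl_set \<P> V E l a0)"
      if "x \<in> V" "limit x \<noteq> a0 x" for x
      using changed_witnessed[OF that] unfolding P_eq by blast
  qed
qed

end
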